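(* The Witt superalgebra $\mathfrak W_{1/2}$ has a unique central extension up to equivalence, i.e. $H_2(\mathfrak W_{1/2},\mathbb C)$ is $1$-dimensional. This extension admits a basis $(L_n)_{n\in\mathbb Z}$, $(G_m)_{m\in\mathbb Z+\frac12}$, $C$, with $C$ central, with $L_n^\star=L_{-n}$, $G_m^\star=G_{-m}$, $C=cI$ with $c\in\mathbb C$ (the central charge), and relations $$[L_m,L_n]=(m-n)L_{m+n}+\tfrac{C}{12}(m^3-m)\delta_{m+n},$$ $$[G_m,L_n]=\big(m-\tfrac n2\big)G_{m+n},$$ $$[G_m,G_n]_+=2L_{m+n}+\tfrac C3\big(m^2-\tfrac14\big)\delta_{m+n},$$ where $\delta_k=1$ if $k=0$ and $\delta_k=0$ otherwise.
   Context: $\mathfrak W_{1/2}$ is the complex Lie superalgebra with even part $\bigoplus_{n\in\mathbb Z}\mathbb C d_n$, odd part $\bigoplus_{m\in\mathbb Z+1/2}\mathbb C\gamma_m$, brackets $[d_m,d_n]=(m-n)d_{m+n}$, $[\gamma_m,d_n]=(m-\frac n2)\gamma_{m+n}$, $[\gamma_m,\gamma_n]_+=2d_{m+n}$, and $\star$-structure $d_n^\star=d_{-n}$, $\gamma_m^\star=\gamma_{-m}$. $H_2(\mathfrak W_{1/2},\mathbb C)$ denotes the space of scalar $2$-cocycles $b:\mathfrak W_{1/2}\times\mathfrak W_{1/2}\to\mathbb C$ (bilinear maps such that the graded bracket $[A,B]+b(A,B)C$ defines a central extension by $\mathbb C C$) modulo the $2$-coboundaries $(A,B)\mapsto f([A,B])$,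 $f$ a linear form; "unique central extension" means unique non-trivial one-dimensional central extension up to equivalence and rescaling of the central element. "$C=cI$" means that $C$ acts as the scalar $c$ in the (irreducible) projective representations considered. *)

theory Defs
  imports Complex_Main "HOL-Library.Poly_Mapping" "HOL-Library.Z2" "HOL-Library.Product_Plus"
begin

section \<open>Complex super vector spaces and Lie superalgebras\<close>

text \<open>Parities are elements of the type \<open>bit\<close>, the field with two elements. A super vector space
  lives on a whole type; its scalar multiplication and its two homogeneous parts are data.\<close>

record 'a sspace =
  scl :: "complex \<Rightarrow> 'a \<Rightarrow> 'a"
  part :: "bit \<Rightarrow> 'a set"

record 'a salgebra = "'a sspace" +
  brk :: "'a \<Rightarrow> 'a \<Rightarrow> 'a"

definition ksign :: "bit \<Rightarrow> bit \<Rightarrow> complex" where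
  "ksign p q = (if p = 1 \<and> q = 1 then - 1 else 1)"

locale super_space = vector_space "scl V"
  for V :: "('a::ab_group_add, 'm) sspace_scheme" +
  assumes subspace_part: "subspace (part V p)"
    and part_inter: "part V 0 \<inter> part V 1 = {0}"
    and part_sum: "\<exists>y\<in>part V 0. \<exists>z\<in>part V 1. x = y + z"

locale lie_superalgebra = super_space A
  for A :: "('a::ab_group_add, 'm) salgebra_scheme" +
  assumes linear_left: "Vector_Spaces.linear (scl A) (scl A) (\<lambda>x. brk A x y)"
    and linear_right: "Vector_Spaces.linear (scl A) (scl A) (\<lambda>y. brk A x y)"
    and brk_part: "x \<in> part A p \<Longrightarrow> y \<in> part A q \<Longrightarrow> brk A x y \<in> part A (p + q)"
    and skew: "x \<in> part A p \<Longrightarrow> y \<in> part A q \<Longrightarrow> brk A x y = scl A (- ksign p q) (brk A y x)"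
    and jacobi: "x \<in> part A p \<Longrightarrow> y \<in> part A q \<Longrightarrow> z \<in> part A r \<Longrightarrow>
      brk A x (brk A y z) = brk A (brk A x y) z + scl A (ksign p q) (brk A y (brk A x z))"

definition lie_hom ::
    "('a::ab_group_add) salgebra \<Rightarrow> ('b::ab_group_add) salgebra \<Rightarrow> ('a \<Rightarrow> 'b) \<Rightarrow> bool" where
  "lie_hom A B f \<longleftrightarrow> Vector_Spaces.linear (scl A) (scl B) f
     \<and> (\<forall>p. f ` part A p \<subseteq> part B p) \<and> (\<forall>x y. f (brk A x y) = brk B (f x) (f y))"

text \<open>A \<open>\<star>\<close>-structure: an even conjugate-linear involution reversing brackets.\<close>

definition star_structure :: "('a::ab_group_add) salgebra \<Rightarrow> ('a \<Rightarrow> 'a) \<Rightarrow> bool" where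
  "star_structure A st \<longleftrightarrow> (\<forall>x y. st (x + y) = st x + st y)
     \<and> (\<forall>c x. st (scl A c x) = scl A (cnj c) (st x)) \<and> (\<forall>x. st (st x) = x)
     \<and> (\<forall>p. st ` part A p \<subseteq> part A p) \<and> (\<forall>x y. st (brk A x y) = brk A (st y) (st x))"


section \<open>Central extensions by one even element\<close>

definition central_extension ::
    "('a::ab_group_add) salgebra \<Rightarrow> ('e::ab_group_add) salgebra \<Rightarrow> ('e \<Rightarrow> 'a) \<Rightarrow> 'e \<Rightarrow> bool" where
  "central_extension A E \<pi> C \<longleftrightarrow> lie_superalgebra A \<and> lie_superalgebra E
     \<and> lie_hom E A \<pi> \<and> surj \<pi> \<and> {x. \<pi> x = 0} = range (\<lambda>c. scl E c C)
     \<and> C \<noteq> 0 \<and> C \<in> part E 0 \<and> (\<forall>x. brk E C x = 0)"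

definition trivial_extension ::
    "('a::ab_group_add) salgebra \<Rightarrow> ('e::ab_group_add) salgebra \<Rightarrow> ('e \<Rightarrow> 'a) \<Rightarrow> bool" where
  "trivial_extension A E \<pi> \<longleftrightarrow> (\<exists>s. lie_hom A E s \<and> (\<forall>x. \<pi> (s x) = x))"

definition equivalent_extensions ::
    "('e::ab_group_add) salgebra \<Rightarrow> ('e \<Rightarrow> 'a) \<Rightarrow> 'e \<Rightarrow> ('f::ab_group_add) salgebra \<Rightarrow> ('f \<Rightarrow> 'a) \<Rightarrow> 'f \<Rightarrow> bool"
  where
  "equivalent_extensions E \<pi> C F \<rho> D \<longleftrightarrow>
     (\<exists>\<phi>. lie_hom E F \<phi> \<and> bij \<phi> \<and> (\<forall>x. \<rho> (\<phi> x) = \<pi> x) \<and> \<phi> C = D)"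


section \<open>Scalar two-cocycles and coboundaries\<close>

definition extension_algebra ::
    "('a::ab_group_add) salgebra \<Rightarrow> ('a \<Rightarrow> 'a \<Rightarrow> complex) \<Rightarrow> ('a \<times> complex) salgebra" where
  "extension_algebra A b =
     \<lparr>scl = (\<lambda>c u. (scl A c (fst u), c * snd u)),
      part = (\<lambda>p. part A p \<times> (if p = 0 then UNIV else {0})),
      brk = (\<lambda>u v. (brk A (fst u) (fst v), b (fst u) (fst v)))\<rparr>"

definition bilinear_form :: "('a::ab_group_add) salgebra \<Rightarrow> ('a \<Rightarrow> 'a \<Rightarrow> complex) \<Rightarrow> bool" where
  "bilinear_form A b \<longleftrightarrow> (\<forall>y. Vector_Spaces.linear (scl A) (*) (\<lambda>x. b x y))
     \<and> (\<forall>x. Vector_Spaces.linear (scl A) (*) (b x))"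

definition two_cocycle :: "('a::ab_group_add) salgebra \<Rightarrow> ('a \<Rightarrow> 'a \<Rightarrow> complex) \<Rightarrow> bool" where
  "two_cocycle A b \<longleftrightarrow> bilinear_form A b \<and> central_extension A (extension_algebra A b) fst (0, 1)"

definition two_coboundary :: "('a::ab_group_add) salgebra \<Rightarrow> ('a \<Rightarrow> 'a \<Rightarrow> complex) \<Rightarrow> bool" where
  "two_coboundary A b \<longleftrightarrow>
     (\<exists>f. Vector_Spaces.linear (scl A) (*) f \<and> (\<forall>x y. b x y = f (brk A x y)))"


section \<open>Representations\<close>

text \<open>\<open>\<beta>\<close> is the scalar by which \<open>\<rho>\<close> fails to be multiplicative. Bilinearity of \<open>\<beta>\<close> and the
  cocycle identity follow when the representation space is nonzero.\<close>

definition projective_representation ::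
    "('a::ab_group_add) salgebra \<Rightarrow> ('v::ab_group_add) sspace \<Rightarrow> ('a \<Rightarrow> 'v \<Rightarrow> 'v)
      \<Rightarrow> ('a \<Rightarrow> 'a \<Rightarrow> complex) \<Rightarrow> bool" where
  "projective_representation A V \<rho> \<beta> \<longleftrightarrow> super_space V
     \<and> (\<forall>v. Vector_Spaces.linear (scl A) (scl V) (\<lambda>x. \<rho> x v))
     \<and> (\<forall>x. Vector_Spaces.linear (scl V) (scl V) (\<rho> x))
     \<and> (\<forall>p q. \<forall>x\<in>part A p. \<forall>v\<in>part V q. \<rho> x v \<in> part V (p + q))
     \<and> (\<forall>p q. \<forall>x\<in>part A p. \<forall>y\<in>part A q. \<forall>v.
          \<rho> x (\<rho> y v) - scl V (ksign p q) (\<rho> y (\<rho> x v)) = \<rho> (brk A x y) v + scl V (\<beta> x y) v)"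

definition representation ::
    "('a::ab_group_add) salgebra \<Rightarrow> ('v::ab_group_add) sspace \<Rightarrow> ('a \<Rightarrow> 'v \<Rightarrow> 'v) \<Rightarrow> bool" where
  "representation A V \<rho> \<longleftrightarrow> projective_representation A V \<rho> (\<lambda>_ _. 0)"

definition irreducible_action :: "('v::ab_group_add) sspace \<Rightarrow> ('a \<Rightarrow> 'v \<Rightarrow> 'v) \<Rightarrow> bool" where
  "irreducible_action V \<rho> \<longleftrightarrow> (UNIV :: 'v set) \<noteq> {0}
     \<and> (\<forall>W. module.subspace (scl V) W
            \<and> (\<forall>w\<in>W. \<exists>w0\<in>W \<inter> part V 0. \<exists>w1\<in>W \<inter> part V 1. w = w0 + w1)
            \<and> (\<forall>x. \<rho> x ` W \<subseteq> W) \<longrightarrow> W = {0} \<or> W = UNIV)"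


section \<open>The Witt superalgebra\<close>

text \<open>\<open>Dgen n\<close> stands for $d_n$ and \<open>Ggen k\<close> for $\gamma_{k + 1/2}$: the half-integer
  index of an odd generator is encoded by the integer just below it.\<close>

datatype gen = Dgen int | Ggen int

type_synonym witt = "gen \<Rightarrow>\<^sub>0 complex"

definition half :: "int \<Rightarrow> complex" where
  "half k = of_int k + 1 / 2"

fun gen_parity :: "gen \<Rightarrow> bit" where
  "gen_parity (Dgen n) = 0"
| "gen_parity (Ggen k) = 1"

fun gen_brk :: "gen \<Rightarrow> gen \<Rightarrow> witt" where
  "gen_brk (Dgen m) (Dgen n) = Poly_Mapping.single (Dgen (m + n)) (of_int m - of_int n)"
| "gen_brk (Ggen k) (Dgen n) = Poly_Mapping.single (Ggen (k + n)) (half k - of_int n / 2)"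
| "gen_brk (Dgen n) (Ggen k) = Poly_Mapping.single (Ggen (k + n)) (- (half k - of_int n / 2))"
| "gen_brk (Ggen k) (Ggen l) = Poly_Mapping.single (Dgen (k + l + 1)) 2"

fun gen_star :: "gen \<Rightarrow> gen" where
  "gen_star (Dgen n) = Dgen (- n)"
| "gen_star (Ggen k) = Ggen (- k - 1)"

definition witt_scl :: "complex \<Rightarrow> witt \<Rightarrow> witt" where
  "witt_scl c x = Poly_Mapping.map ((*) c) x"

definition witt_brk :: "witt \<Rightarrow> witt \<Rightarrow> witt" where
  "witt_brk x y = (\<Sum>i\<in>Poly_Mapping.keys x. \<Sum>j\<in>Poly_Mapping.keys y.
     witt_scl (Poly_Mapping.lookup x i * Poly_Mapping.lookup y j) (gen_brk i j))"

definition witt_alg :: "witt salgebra" where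
  "witt_alg = \<lparr>scl = witt_scl,
     part = (\<lambda>p. {x. \<forall>i\<in>Poly_Mapping.keys x. gen_parity i = p}),
     brk = witt_brk\<rparr>"

definition witt_star :: "witt \<Rightarrow> witt" where
  "witt_star x = (\<Sum>i\<in>Poly_Mapping.keys x.
     Poly_Mapping.single (gen_star i) (cnj (Poly_Mapping.lookup x i)))"

definition wittd :: "int \<Rightarrow> witt" where
  "wittd n = Poly_Mapping.single (Dgen n) 1"

definition wittg :: "int \<Rightarrow> witt" where
  "wittg k = Poly_Mapping.single (Ggen k) 1"

lemma lookup_witt_scl [simp]:
  "Poly_Mapping.lookup (witt_scl c x) i = c * Poly_Mapping.lookup x i"
  by (simp add: witt_scl_def Poly_Mapping.map.rep_eq when_def)

lemma vector_space_witt: "vector_space witt_scl"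
  by unfold_locales (auto intro!: poly_mapping_eqI simp: lookup_add algebra_simps)

lemma witt_brk_superset:
  assumes "finite S" "Poly_Mapping.keys x \<subseteq> S" "finite T" "Poly_Mapping.keys y \<subseteq> T"
  shows "witt_brk x y = (\<Sum>i\<in>S. \<Sum>j\<in>T.
     witt_scl (Poly_Mapping.lookup x i * Poly_Mapping.lookup y j) (gen_brk i j))"
proof -
  interpret vector_space witt_scl by (rule vector_space_witt)
  have "witt_brk x y = (\<Sum>i\<in>Poly_Mapping.keys x. \<Sum>j\<in>T.
     witt_scl (Poly_Mapping.lookup x i * Poly_Mapping.lookup y j) (gen_brk i j))"
    unfolding witt_brk_def using assms
    by (intro sum.cong sum.mono_neutral_left) (auto simp: in_keys_iff)
  also have "\<dots> = (\<Sum>i\<in>S. \<Sum>j\<in>T.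
     witt_scl (Poly_Mapping.lookup x i * Poly_Mapping.lookup y j) (gen_brk i j))"
    using assms by (intro sum.mono_neutral_left) (auto simp: in_keys_iff)
  finally show ?thesis .
qed

lemma witt_brk_add_left: "witt_brk (x + x') y = witt_brk x y + witt_brk x' y"
proof -
  interpret vector_space witt_scl by (rule vector_space_witt)
  let ?S = "Poly_Mapping.keys x \<union> Poly_Mapping.keys x'"
  have *: "finite ?S" "Poly_Mapping.keys (x + x') \<subseteq> ?S" "Poly_Mapping.keys x \<subseteq> ?S" "Poly_Mapping.keys x' \<subseteq> ?S"
    using keys_add[of x x'] by auto
  show ?thesis
    by (simp add: witt_brk_superset[OF *(1,2) finite_keys subset_refl]
        witt_brk_superset[OF *(1,3) finite_keys subset_refl]
        witt_brk_superset[OF *(1,4) finite_keys subset_refl]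
        lookup_add ring_distribs scale_left_distrib sum.distrib)
qed

lemma witt_brk_add_right: "witt_brk y (x + x') = witt_brk y x + witt_brk y x'"
proof -
  interpret vector_space witt_scl by (rule vector_space_witt)
  let ?S = "Poly_Mapping.keys x \<union> Poly_Mapping.keys x'"
  have *: "finite ?S" "Poly_Mapping.keys (x + x') \<subseteq> ?S" "Poly_Mapping.keys x \<subseteq> ?S" "Poly_Mapping.keys x' \<subseteq> ?S"
    using keys_add[of x x'] by auto
  show ?thesis
    by (simp add: witt_brk_superset[OF finite_keys subset_refl *(1,2)]
        witt_brk_superset[OF finite_keys subset_refl *(1,3)]
        witt_brk_superset[OF finite_keys subset_refl *(1,4)]
        lookup_add ring_distribs scale_left_distrib sum.distrib)
qed

lemma keys_witt_scl: "Poly_Mapping.keys (witt_scl c x) \<subseteq> Poly_Mapping.keys x"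
  by (auto simp: in_keys_iff)

lemma witt_brk_scl_left: "witt_brk (witt_scl c x) y = witt_scl c (witt_brk x y)"
proof -
  interpret vector_space witt_scl by (rule vector_space_witt)
  show ?thesis
    unfolding witt_brk_superset[OF finite_keys keys_witt_scl finite_keys subset_refl, of c]
    by (simp add: witt_brk_def scale_sum_right mult.assoc)
qed

lemma witt_brk_scl_right: "witt_brk y (witt_scl c x) = witt_scl c (witt_brk y x)"
proof -
  interpret vector_space witt_scl by (rule vector_space_witt)
  show ?thesis
    unfolding witt_brk_superset[OF finite_keys subset_refl finite_keys keys_witt_scl, of _ c]
    by (simp add: witt_brk_def scale_sum_right mult_ac)
qed

lemma witt_brk_single [simp]:
  "witt_brk (Poly_Mapping.single i 1) (Poly_Mapping.single j 1) = gen_brk i j"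
proof -
  interpret vector_space witt_scl by (rule vector_space_witt)
  show ?thesis by (simp add: witt_brk_def)
qed

lemma witt_expansion:
  "x = (\<Sum>i\<in>Poly_Mapping.keys x. witt_scl (Poly_Mapping.lookup x i) (Poly_Mapping.single i 1))"
  by (rule poly_mapping_eqI)
     (simp add: lookup_sum lookup_single when_def in_keys_iff if_distrib[of "\<lambda>t. _ * t"]
       sum.delta not_in_keys_iff_lookup_eq_zero cong: if_cong)

lemma witt_linear_eqI:
  fixes f g :: "witt \<Rightarrow> witt"
  assumes f: "\<And>x y. f (x + y) = f x + f y" "\<And>c x. f (witt_scl c x) = witt_scl c (f x)"
    and g: "\<And>x y. g (x + y) = g x + g y" "\<And>c x. g (witt_scl c x) = witt_scl c (g x)"
    and eq: "\<And>i. i \<in> Poly_Mapping.keys x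
      \<Longrightarrow> f (Poly_Mapping.single i 1) = g (Poly_Mapping.single i 1)"
  shows "f x = g x"
proof -
  interpret F: Vector_Spaces.linear witt_scl witt_scl f
    using f vector_space_witt by (simp add: Vector_Spaces.linear_iff)
  interpret G: Vector_Spaces.linear witt_scl witt_scl g
    using g vector_space_witt by (simp add: Vector_Spaces.linear_iff)
  have "f x = f (\<Sum>i\<in>Poly_Mapping.keys x. witt_scl (Poly_Mapping.lookup x i) (Poly_Mapping.single i 1))"
    using witt_expansion[of x] by simp
  also have "\<dots> = g (\<Sum>i\<in>Poly_Mapping.keys x. witt_scl (Poly_Mapping.lookup x i) (Poly_Mapping.single i 1))"
    by (simp add: F.sum G.sum f g eq)
  also have "\<dots> = g x"
    using witt_expansion[of x] by simp
  finally show ?thesis .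
qed

lemma super_space_witt: "super_space witt_alg"
proof -
  interpret vector_space witt_scl by (rule vector_space_witt)
  show ?thesis
  proof (intro super_space.intro super_space_axioms.intro)
    show "vector_space (scl witt_alg)" by (simp add: witt_alg_def vector_space_witt)
    fix p
    show "module.subspace (scl witt_alg) (part witt_alg p)"
      unfolding witt_alg_def
      using keys_add by (fastforce simp: subspace_def in_keys_iff)
  next
    show "part witt_alg 0 \<inter> part witt_alg 1 = {0}"
      by (auto simp: witt_alg_def intro!: poly_mapping_eqI)
  next
    fix x :: witt
    let ?f = "\<lambda>p. \<Sum>i\<in>{i\<in>Poly_Mapping.keys x. gen_parity i = p}. Poly_Mapping.single i (Poly_Mapping.lookup x i)"
    have lk: "Poly_Mapping.lookup (?f p) i = (if gen_parity i = p then Poly_Mapping.lookup x i else 0)" for p i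
      by (auto simp: lookup_sum lookup_single when_def not_in_keys_iff_lookup_eq_zero)
    have "x = ?f 0 + ?f 1"
    proof (rule poly_mapping_eqI)
      fix i show "Poly_Mapping.lookup x i = Poly_Mapping.lookup (?f 0 + ?f 1) i"
        by (cases i) (simp_all only: lookup_add lk gen_parity.simps, simp_all)
    qed
    moreover have "?f p \<in> part witt_alg p" for p
      using lk[of p] by (auto simp: witt_alg_def in_keys_iff split: if_splits)
    ultimately show "\<exists>y\<in>part witt_alg 0. \<exists>z\<in>part witt_alg 1. x = y + z" by blast
  qed
qed

lemma witt_brk_single_right_half:
  "witt_brk (Poly_Mapping.single i 1) (Poly_Mapping.single j c) = witt_scl c (gen_brk i j)"
proof -
  have "Poly_Mapping.single j c = witt_scl c (Poly_Mapping.single j 1)"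
    by (auto intro!: poly_mapping_eqI simp: lookup_single when_def)
  then show ?thesis by (simp add: witt_brk_scl_right)
qed

lemma witt_brk_single_left_half:
  "witt_brk (Poly_Mapping.single j c) (Poly_Mapping.single i 1) = witt_scl c (gen_brk j i)"
proof -
  have "Poly_Mapping.single j c = witt_scl c (Poly_Mapping.single j 1)"
    by (auto intro!: poly_mapping_eqI simp: lookup_single when_def)
  then show ?thesis by (simp add: witt_brk_scl_left)
qed

lemma witt_scl_single [simp]: "witt_scl c (Poly_Mapping.single i a) = Poly_Mapping.single i (c * a)"
  by (auto intro!: poly_mapping_eqI simp: lookup_single when_def)

lemma gen_skew: "gen_brk i j = witt_scl (- ksign (gen_parity i) (gen_parity j)) (gen_brk j i)"
  by (cases i; cases j) (simp_all add: ksign_def add.commute)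

lemma gen_jacobi:
  "witt_brk (Poly_Mapping.single i 1) (gen_brk j k) =
     witt_brk (gen_brk i j) (Poly_Mapping.single k 1)
     + witt_scl (ksign (gen_parity i) (gen_parity j)) (witt_brk (Poly_Mapping.single j 1) (gen_brk i k))"
  by (cases i; cases j; cases k)
     (simp_all add: witt_brk_single_right_half witt_brk_single_left_half ksign_def
       single_add[symmetric] half_def ac_simps,
      (rule arg_cong[where f = "Poly_Mapping.single _"], simp add: field_simps)+)

lemma lie_superalgebra_witt: "lie_superalgebra witt_alg"
proof -
  interpret vector_space witt_scl by (rule vector_space_witt)
  note lin = witt_brk_add_left witt_brk_add_right witt_brk_scl_left witt_brk_scl_right
    scale_right_distrib mult.commute
  show ?thesis
  proof (intro lie_superalgebra.intro super_space_witt lie_superalgebra_axioms.intro)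
    show "Vector_Spaces.linear (scl witt_alg) (scl witt_alg) (\<lambda>x. brk witt_alg x y)" for y
      by (simp add: witt_alg_def Vector_Spaces.linear_iff vector_space_witt lin)
    show "Vector_Spaces.linear (scl witt_alg) (scl witt_alg) (\<lambda>y. brk witt_alg x y)" for x
      by (simp add: witt_alg_def Vector_Spaces.linear_iff vector_space_witt lin)
  next
    fix x y p q assume "x \<in> part witt_alg p" "y \<in> part witt_alg q"
    then have x: "\<And>i. i \<in> Poly_Mapping.keys x \<Longrightarrow> gen_parity i = p"
      and y: "\<And>i. i \<in> Poly_Mapping.keys y \<Longrightarrow> gen_parity i = q" by (auto simp: witt_alg_def)
    interpret S: super_space witt_alg by (rule super_space_witt)
    have gp: "gen_brk i j \<in> part witt_alg (gen_parity i + gen_parity j)" for i j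
      by (cases i; cases j) (auto simp: witt_alg_def split: if_splits)
    show "brk witt_alg x y \<in> part witt_alg (p + q)"
    proof -
      have "witt_scl c (gen_brk i j) \<in> part witt_alg (p + q)"
        if "i \<in> Poly_Mapping.keys x" "j \<in> Poly_Mapping.keys y" for i j c
        using gp[of i j] x[OF that(1)] y[OF that(2)] S.subspace_scale[OF S.subspace_part, of _ "p+q" c]
        by (auto simp: witt_alg_def)
      then have "witt_brk x y \<in> part witt_alg (p + q)"
        unfolding witt_brk_def by (intro S.subspace_sum[OF S.subspace_part]) auto
      then show ?thesis by (simp add: witt_alg_def)
    qed
    have "witt_brk x y = witt_scl (- ksign p q) (witt_brk y x)"
    proof (rule witt_linear_eqI[where x = x])
      fix i assume i: "i \<in> Poly_Mapping.keys x"
      show "witt_brk (Poly_Mapping.single i 1) y = witt_scl (- ksign p q) (witt_brk y (Poly_Mapping.single i 1))"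
      proof (rule witt_linear_eqI[where x = y])
        fix j assume j: "j \<in> Poly_Mapping.keys y"
        show "witt_brk (Poly_Mapping.single i 1) (Poly_Mapping.single j 1)
           = witt_scl (- ksign p q) (witt_brk (Poly_Mapping.single j 1) (Poly_Mapping.single i 1))"
          unfolding witt_brk_single using gen_skew[of i j] x[OF i] y[OF j] by simp
      qed (simp_all add: lin)
    qed (simp_all add: lin)
    then show "brk witt_alg x y = scl witt_alg (- ksign p q) (brk witt_alg y x)"
      by (simp add: witt_alg_def)
  next
    fix x y z p q r
    assume "x \<in> part witt_alg p" "y \<in> part witt_alg q" "z \<in> part witt_alg r"
    then have x: "\<And>i. i \<in> Poly_Mapping.keys x \<Longrightarrow> gen_parity i = p"
      and y: "\<And>i. i \<in> Poly_Mapping.keys y \<Longrightarrow> gen_parity i = q" by (auto simp: witt_alg_def)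
    have "witt_brk x (witt_brk y z)
      = witt_brk (witt_brk x y) z + witt_scl (ksign p q) (witt_brk y (witt_brk x z))"
    proof (rule witt_linear_eqI[where x = x])
      fix i assume i: "i \<in> Poly_Mapping.keys x"
      let ?i = "Poly_Mapping.single i 1 :: witt"
      show "witt_brk ?i (witt_brk y z)
        = witt_brk (witt_brk ?i y) z + witt_scl (ksign p q) (witt_brk y (witt_brk ?i z))"
      proof (rule witt_linear_eqI[where x = y])
        fix j assume j: "j \<in> Poly_Mapping.keys y"
        let ?j = "Poly_Mapping.single j 1 :: witt"
        show "witt_brk ?i (witt_brk ?j z)
          = witt_brk (witt_brk ?i ?j) z + witt_scl (ksign p q) (witt_brk ?j (witt_brk ?i z))"
        proof (rule witt_linear_eqI[where x = z])
          fix k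
          let ?k = "Poly_Mapping.single k 1 :: witt"
          show "witt_brk ?i (witt_brk ?j ?k)
            = witt_brk (witt_brk ?i ?j) ?k + witt_scl (ksign p q) (witt_brk ?j (witt_brk ?i ?k))"
            unfolding witt_brk_single using gen_jacobi[of i j k] x[OF i] y[OF j] by simp
        qed (simp_all add: lin)
      qed (simp_all add: lin)
    qed (simp_all add: lin)
    then show "brk witt_alg x (brk witt_alg y z) = brk witt_alg (brk witt_alg x y) z
        + scl witt_alg (ksign p q) (brk witt_alg y (brk witt_alg x z))"
      by (simp add: witt_alg_def)
  qed
qed

lemma witt_star_superset:
  assumes "finite S" "Poly_Mapping.keys x \<subseteq> S"
  shows "witt_star x = (\<Sum>i\<in>S. Poly_Mapping.single (gen_star i) (cnj (Poly_Mapping.lookup x i)))"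
  unfolding witt_star_def using assms by (intro sum.mono_neutral_left) (auto simp: in_keys_iff)

lemma gen_star_invol [simp]: "gen_star (gen_star i) = i"
  by (cases i) auto

lemma lookup_witt_star: "Poly_Mapping.lookup (witt_star x) i = cnj (Poly_Mapping.lookup x (gen_star i))"
proof -
  have *: "gen_star j = i \<longleftrightarrow> j = gen_star i" for j by (metis gen_star_invol)
  show ?thesis
    by (auto simp: witt_star_def lookup_sum lookup_single when_def * in_keys_iff)
qed

lemma witt_star_single [simp]:
  "witt_star (Poly_Mapping.single i c) = Poly_Mapping.single (gen_star i) (cnj c)"
proof -
  have *: "i = gen_star j \<longleftrightarrow> gen_star i = j" for j by (metis gen_star_invol)
  show ?thesis by (auto intro!: poly_mapping_eqI simp: lookup_witt_star lookup_single when_def *)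
qed

lemma witt_star_add: "witt_star (x + y) = witt_star x + witt_star y"
  by (rule poly_mapping_eqI) (simp add: lookup_witt_star lookup_add)

lemma witt_star_scl: "witt_star (witt_scl c x) = witt_scl (cnj c) (witt_star x)"
  by (rule poly_mapping_eqI) (simp add: lookup_witt_star)

lemma witt_star_invol: "witt_star (witt_star x) = x"
  by (rule poly_mapping_eqI) (simp add: lookup_witt_star)

lemma gen_star_brk: "witt_star (gen_brk i j) = gen_brk (gen_star j) (gen_star i)"
  by (cases i; cases j)
     (simp_all add: half_def algebra_simps add_divide_distrib diff_divide_distrib)

lemma star_structure_witt: "star_structure witt_alg witt_star"
proof -
  note lin = witt_brk_add_left witt_brk_add_right witt_brk_scl_left witt_brk_scl_right
    witt_star_add witt_star_scl
  have "witt_star (witt_star (witt_brk x y)) = witt_star (witt_brk (witt_star y) (witt_star x))" for x y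
  proof (rule witt_linear_eqI[where x = x])
    fix i
    let ?i = "Poly_Mapping.single i 1 :: witt"
    show "witt_star (witt_star (witt_brk ?i y)) = witt_star (witt_brk (witt_star y) (witt_star ?i))"
    proof (rule witt_linear_eqI[where x = y])
      fix j
      let ?j = "Poly_Mapping.single j 1 :: witt"
      show "witt_star (witt_star (witt_brk ?i ?j)) = witt_star (witt_brk (witt_star ?j) (witt_star ?i))"
        by (simp add: gen_star_brk)
    qed (simp_all add: lin)
  qed (simp_all add: lin)
  then have "witt_star (witt_brk x y) = witt_brk (witt_star y) (witt_star x)" for x y
    by (metis witt_star_invol)
  moreover have "gen_parity (gen_star i) = gen_parity i" for i by (cases i) auto
  then have "witt_star x \<in> part witt_alg p" if "x \<in> part witt_alg p" for p x
  proof -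
    have "gen_star i \<in> Poly_Mapping.keys x" if "i \<in> Poly_Mapping.keys (witt_star x)" for i
      using that unfolding in_keys_iff lookup_witt_star by auto
    then show ?thesis
      using that \<open>\<And>i. gen_parity (gen_star i) = gen_parity i\<close> by (fastforce simp: witt_alg_def)
  qed
  then have "witt_star ` part witt_alg p \<subseteq> part witt_alg p" for p by blast
  ultimately show ?thesis
    by (simp add: star_structure_def witt_star_add witt_star_invol)
       (simp add: witt_alg_def witt_star_scl)
qed


section \<open>Second cohomology of the Witt superalgebra\<close>

lemma vector_space_complex: "vector_space ((*) :: complex \<Rightarrow> complex \<Rightarrow> complex)"
  by unfold_locales (auto simp: algebra_simps)

lemma two_cocycle_iff:
  assumes A: "lie_superalgebra A"
  shows "two_cocycle A b \<longleftrightarrow> bilinear_form A b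
    \<and> (\<forall>p q. \<forall>x\<in>part A p. \<forall>y\<in>part A q. p + q \<noteq> 0 \<longrightarrow> b x y = 0)
    \<and> (\<forall>p q. \<forall>x\<in>part A p. \<forall>y\<in>part A q. b x y = - ksign p q * b y x)
    \<and> (\<forall>p q r. \<forall>x\<in>part A p. \<forall>y\<in>part A q. \<forall>z\<in>part A r.
         b x (brk A y z) = b (brk A x y) z + ksign p q * b y (brk A x z))"
    (is "_ \<longleftrightarrow> ?R")
proof
  interpret A: lie_superalgebra A by fact
  have zero: "0 \<in> part A p" for p using A.subspace_0[OF A.subspace_part] .
  {
    assume "two_cocycle A b"
    then have bl: "bilinear_form A b" and "lie_superalgebra (extension_algebra A b)"
      by (auto simp: two_cocycle_def central_extension_def)
    then interpret E: lie_superalgebra "extension_algebra A b" by simp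
    have in_part: "(x, 0) \<in> part (extension_algebra A b) p" if "x \<in> part A p" for x p
      using that by (simp add: extension_algebra_def)
    show ?R
    proof (intro conjI allI ballI impI bl)
      fix p q x y assume xy: "x \<in> part A p" "y \<in> part A q"
      show "b x y = 0" if "p + q \<noteq> 0"
        using E.brk_part[OF in_part[OF xy(1)] in_part[OF xy(2)]] that
        by (simp add: extension_algebra_def del: add_bit_eq_xor split: if_splits)
      show "b x y = - ksign p q * b y x"
        using E.skew[OF in_part[OF xy(1)] in_part[OF xy(2)]]
        by (simp add: extension_algebra_def)
    next
      fix p q r x y z assume xyz: "x \<in> part A p" "y \<in> part A q" "z \<in> part A r"
      show "b x (brk A y z) = b (brk A x y) z + ksign p q * b y (brk A x z)"
        using E.jacobi[OF in_part[OF xyz(1)] in_part[OF xyz(2)] in_part[OF xyz(3)]]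
        by (simp add: extension_algebra_def)
    qed
  }
  {
    assume R: ?R
    then have bl: "bilinear_form A b" by blast
    have bz: "b 0 y = 0" "b x 0 = 0" for x y
      using bl vector_space_complex unfolding bilinear_form_def
      by (metis A.scale_zero_left Vector_Spaces.linear_iff mult_zero_left)+
    have vs: "vector_space (scl (extension_algebra A b))"
      by unfold_locales
         (auto simp: extension_algebra_def A.scale_right_distrib A.scale_left_distrib algebra_simps)
    interpret E: vector_space "scl (extension_algebra A b)" by (rule vs)
    have "lie_superalgebra (extension_algebra A b)"
    proof (intro lie_superalgebra.intro lie_superalgebra_axioms.intro super_space.intro
        super_space_axioms.intro vs)
      fix p show "E.subspace (part (extension_algebra A b) p)"
        using A.subspace_part[of p]
        unfolding E.subspace_def A.subspace_def
        by (auto simp: extension_algebra_def zero_prod_def)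
    next
      show "part (extension_algebra A b) 0 \<inter> part (extension_algebra A b) 1 = {0}"
        by (simp add: extension_algebra_def zero_prod_def Times_Int_Times A.part_inter)
    next
      fix x :: "'a \<times> complex"
      obtain y z where "y \<in> part A 0" "z \<in> part A 1" "fst x = y + z" using A.part_sum by blast
      then show "\<exists>y\<in>part (extension_algebra A b) 0. \<exists>z\<in>part (extension_algebra A b) 1. x = y + z"
        by (intro bexI[of _ "(y, snd x)"] bexI[of _ "(z, 0)"])
           (auto simp: extension_algebra_def prod_eq_iff)
    next
      fix y
      show "Vector_Spaces.linear (scl (extension_algebra A b)) (scl (extension_algebra A b))
          (\<lambda>x. brk (extension_algebra A b) x y)"
        using vs bl A.linear_left by (auto simp: Vector_Spaces.linear_iff bilinear_form_def extension_algebra_def)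
      show "Vector_Spaces.linear (scl (extension_algebra A b)) (scl (extension_algebra A b))
          (\<lambda>x. brk (extension_algebra A b) y x)"
        using vs bl A.linear_right by (auto simp: Vector_Spaces.linear_iff bilinear_form_def extension_algebra_def)
    next
      fix x y p q
      assume "x \<in> part (extension_algebra A b) p" "y \<in> part (extension_algebra A b) q"
      then have xy: "fst x \<in> part A p" "fst y \<in> part A q" by (auto simp: extension_algebra_def)
      have "p + q \<noteq> 0 \<longrightarrow> b (fst x) (fst y) = 0" using R xy by blast
      then show "brk (extension_algebra A b) x y \<in> part (extension_algebra A b) (p + q)"
        using A.brk_part[OF xy] by (simp add: extension_algebra_def del: add_bit_eq_xor)
      have "b (fst x) (fst y) = - ksign p q * b (fst y) (fst x)" using R xy by blast
      then show "brk (extension_algebra A b) x y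
        = scl (extension_algebra A b) (- ksign p q) (brk (extension_algebra A b) y x)"
        using A.skew[OF xy] by (simp add: extension_algebra_def)
    next
      fix x y z p q r
      assume "x \<in> part (extension_algebra A b) p" "y \<in> part (extension_algebra A b) q"
        "z \<in> part (extension_algebra A b) r"
      then have xyz: "fst x \<in> part A p" "fst y \<in> part A q" "fst z \<in> part A r"
        by (auto simp: extension_algebra_def)
      have "b (fst x) (brk A (fst y) (fst z)) = b (brk A (fst x) (fst y)) (fst z)
          + ksign p q * b (fst y) (brk A (fst x) (fst z))"
        using R xyz by blast
      then show "brk (extension_algebra A b) x (brk (extension_algebra A b) y z)
        = brk (extension_algebra A b) (brk (extension_algebra A b) x y) z
          + scl (extension_algebra A b) (ksign p q)
              (brk (extension_algebra A b) y (brk (extension_algebra A b) x z))"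
        using A.jacobi[OF xyz] by (simp add: extension_algebra_def)
    qed
    moreover have "lie_hom (extension_algebra A b) A fst"
      using vs A.vector_space_axioms
      by (auto simp: lie_hom_def Vector_Spaces.linear_iff extension_algebra_def)
    moreover have "brk A 0 y = 0" for y
      using A.linear_left[of y] by (metis A.scale_zero_left Vector_Spaces.linear_iff)
    moreover have "{u. fst u = 0} = range (\<lambda>c. scl (extension_algebra A b) c (0, 1))"
      by (auto simp: extension_algebra_def image_iff prod_eq_iff)
    moreover have "(0, 1) \<noteq> (0 :: 'a \<times> complex)" "(0, 1) \<in> part (extension_algebra A b) 0"
      using zero by (simp_all add: zero_prod_def extension_algebra_def)
    moreover have "\<forall>u. brk (extension_algebra A b) (0, 1) u = 0" if "\<And>y. brk A 0 y = 0"
      using that bz by (simp add: zero_prod_def extension_algebra_def)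
    ultimately show "two_cocycle A b"
      unfolding two_cocycle_def central_extension_def using A bl fst_conv by (auto simp: surj_def)
  }
qed

lemma bilinear_form_add:
  "bilinear_form A b \<Longrightarrow> bilinear_form A b' \<Longrightarrow> bilinear_form A (\<lambda>x y. b x y + b' x y)"
  by (simp add: bilinear_form_def Vector_Spaces.linear_iff algebra_simps)

lemma bilinear_form_scale: "bilinear_form A b \<Longrightarrow> bilinear_form A (\<lambda>x y. c * b x y)"
  by (simp add: bilinear_form_def Vector_Spaces.linear_iff algebra_simps)

lemma two_cocycle_add:
  assumes A: "lie_superalgebra A" and b: "two_cocycle A b" and b': "two_cocycle A b'"
  shows "two_cocycle A (\<lambda>x y. b x y + b' x y)"
  unfolding two_cocycle_iff[OF A]
proof (intro conjI allI ballI impI)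
  note B = b[unfolded two_cocycle_iff[OF A]] b'[unfolded two_cocycle_iff[OF A]]
  show "bilinear_form A (\<lambda>x y. b x y + b' x y)" using B by (intro bilinear_form_add) blast+
  fix p q x y assume xy: "x \<in> part A p" "y \<in> part A q"
  show "b x y + b' x y = 0" if "p + q \<noteq> 0"
  proof -
    have "b x y = 0" using B(1) xy that by blast
    moreover have "b' x y = 0" using B(2) xy that by blast
    ultimately show ?thesis by simp
  qed
  have "b x y = - ksign p q * b y x" using B(1) xy by blast
  moreover have "b' x y = - ksign p q * b' y x" using B(2) xy by blast
  ultimately show "b x y + b' x y = - ksign p q * (b y x + b' y x)"
    by (simp only: distrib_left)
next
  note B = b[unfolded two_cocycle_iff[OF A]] b'[unfolded two_cocycle_iff[OF A]]
  fix p q r x y z assume xyz: "x \<in> part A p" "y \<in> part A q" "z \<in> part A r"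
  have "b x (brk A y z) = b (brk A x y) z + ksign p q * b y (brk A x z)"
    using B(1) xyz by blast
  moreover have "b' x (brk A y z) = b' (brk A x y) z + ksign p q * b' y (brk A x z)"
    using B(2) xyz by blast
  ultimately show "b x (brk A y z) + b' x (brk A y z) = b (brk A x y) z + b' (brk A x y) z
      + ksign p q * (b y (brk A x z) + b' y (brk A x z))"
    by (simp add: algebra_simps)
qed

lemma two_cocycle_scale:
  assumes A: "lie_superalgebra A" and b: "two_cocycle A b"
  shows "two_cocycle A (\<lambda>x y. c * b x y)"
  unfolding two_cocycle_iff[OF A]
proof (intro conjI allI ballI impI)
  note B = b[unfolded two_cocycle_iff[OF A]]
  show "bilinear_form A (\<lambda>x y. c * b x y)" using B by (intro bilinear_form_scale) blast
  fix p q x y assume xy: "x \<in> part A p" "y \<in> part A q"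
  show "c * b x y = 0" if "p + q \<noteq> 0"
  proof -
    have "b x y = 0" using B xy that by blast
    then show ?thesis by simp
  qed
  have "b x y = - ksign p q * b y x" using B xy by blast
  then show "c * b x y = - ksign p q * (c * b y x)"
    by (simp only: mult.left_commute)
next
  note B = b[unfolded two_cocycle_iff[OF A]]
  fix p q r x y z assume xyz: "x \<in> part A p" "y \<in> part A q" "z \<in> part A r"
  have "b x (brk A y z) = b (brk A x y) z + ksign p q * b y (brk A x z)"
    using B xyz by blast
  then show "c * b x (brk A y z) = c * b (brk A x y) z + ksign p q * (c * b y (brk A x z))"
    by (simp add: algebra_simps)
qed

lemma two_cocycle_zero:
  assumes "lie_superalgebra A" shows "two_cocycle A (\<lambda>_ _. 0)"
proof -
  interpret lie_superalgebra A by fact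
  show ?thesis
    by (simp add: two_cocycle_iff[OF assms] bilinear_form_def Vector_Spaces.linear_iff
        vector_space_complex vector_space_axioms)
qed

lemma two_coboundary_add:
  "two_coboundary A b \<Longrightarrow> two_coboundary A b' \<Longrightarrow> two_coboundary A (\<lambda>x y. b x y + b' x y)"
  unfolding two_coboundary_def
proof safe
  fix f g assume "Vector_Spaces.linear (scl A) (*) f" "Vector_Spaces.linear (scl A) (*) g"
    "\<forall>x y. b x y = f (brk A x y)" "\<forall>x y. b' x y = g (brk A x y)"
  then show "\<exists>f. Vector_Spaces.linear (scl A) (*) f \<and> (\<forall>x y. b x y + b' x y = f (brk A x y))"
    by (intro exI[of _ "\<lambda>x. f x + g x"]) (simp add: Vector_Spaces.linear_iff algebra_simps)
qed

lemma two_coboundary_scale: "two_coboundary A b \<Longrightarrow> two_coboundary A (\<lambda>x y. c * b x y)"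
  unfolding two_coboundary_def
proof safe
  fix f assume "Vector_Spaces.linear (scl A) (*) f" "\<forall>x y. b x y = f (brk A x y)"
  then show "\<exists>f. Vector_Spaces.linear (scl A) (*) f \<and> (\<forall>x y. c * b x y = f (brk A x y))"
    by (intro exI[of _ "\<lambda>x. c * f x"]) (simp add: Vector_Spaces.linear_iff algebra_simps)
qed

lemma two_coboundary_zero: "lie_superalgebra A \<Longrightarrow> two_coboundary A (\<lambda>_ _. 0)"
proof -
  assume "lie_superalgebra A"
  then interpret lie_superalgebra A .
  show ?thesis
    by (auto intro!: exI[of _ "\<lambda>_. 0"]
        simp: two_coboundary_def Vector_Spaces.linear_iff vector_space_complex vector_space_axioms)
qed

definition cohomologous :: "(witt \<Rightarrow> witt \<Rightarrow> complex) \<Rightarrow> (witt \<Rightarrow> witt \<Rightarrow> complex) \<Rightarrow> bool" where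
  "cohomologous b b' \<longleftrightarrow> two_cocycle witt_alg b \<and> two_cocycle witt_alg b'
     \<and> two_coboundary witt_alg (\<lambda>x y. b x y - b' x y)"

lemma cohomologous_scale:
  assumes "cohomologous b b'" shows "cohomologous (\<lambda>x y. c * b x y) (\<lambda>x y. c * b' x y)"
  using assms two_coboundary_scale[of witt_alg "\<lambda>x y. b x y - b' x y" c]
  by (simp add: cohomologous_def two_cocycle_scale[OF lie_superalgebra_witt] right_diff_distrib)

lemma part_equivp_cohomologous: "part_equivp cohomologous"
proof (rule part_equivpI)
  note L = lie_superalgebra_witt
  show "\<exists>b. cohomologous b b"
    using two_cocycle_zero[OF L] two_coboundary_zero[OF L] by (auto simp: cohomologous_def)
  show "symp cohomologous"
  proof (rule sympI)
    fix b b' assume "cohomologous b b'"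
    then show "cohomologous b' b"
      using two_coboundary_scale[of witt_alg "\<lambda>x y. b x y - b' x y" "-1"]
      by (simp add: cohomologous_def)
  qed
  show "transp cohomologous"
  proof (rule transpI)
    fix a b c assume "cohomologous a b" "cohomologous b c"
    then show "cohomologous a c"
      using two_coboundary_add[of witt_alg "\<lambda>x y. a x y - b x y" "\<lambda>x y. b x y - c x y"]
      by (simp add: cohomologous_def)
  qed
qed

text \<open>$H_2$ as the type of classes of cocycles modulo coboundaries. The relation is partial:
  only cocycles are related to themselves.\<close>

quotient_type witt_H2 = "witt \<Rightarrow> witt \<Rightarrow> complex" / partial: cohomologous
  by (rule part_equivp_cohomologous)

instantiation witt_H2 :: ab_group_add
begin

lift_definition zero_witt_H2 :: witt_H2 is "\<lambda>_ _. 0"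
  using two_cocycle_zero[OF lie_superalgebra_witt] two_coboundary_zero[OF lie_superalgebra_witt]
  by (simp add: cohomologous_def)

lift_definition plus_witt_H2 :: "witt_H2 \<Rightarrow> witt_H2 \<Rightarrow> witt_H2" is "\<lambda>b b' x y. b x y + b' x y"
  unfolding cohomologous_def
proof (intro conjI; elim conjE)
  fix a b a' b' :: "witt \<Rightarrow> witt \<Rightarrow> complex"
  assume "two_coboundary witt_alg (\<lambda>x y. a x y - b x y)"
    "two_coboundary witt_alg (\<lambda>x y. a' x y - b' x y)"
  from two_coboundary_add[OF this]
  show "two_coboundary witt_alg (\<lambda>x y. a x y + a' x y - (b x y + b' x y))"
    by (simp add: algebra_simps)
qed (rule two_cocycle_add[OF lie_superalgebra_witt]; assumption)+

lift_definition uminus_witt_H2 :: "witt_H2 \<Rightarrow> witt_H2" is "\<lambda>b x y. - b x y"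
  using cohomologous_scale[where c = "-1"] by simp

definition minus_witt_H2 :: "witt_H2 \<Rightarrow> witt_H2 \<Rightarrow> witt_H2" where
  "minus_witt_H2 u v = u + (- v)"

instance
proof
  have refl: "two_coboundary witt_alg (\<lambda>_ _. 0)"
    by (rule two_coboundary_zero[OF lie_superalgebra_witt])
  note cl = two_cocycle_zero[OF lie_superalgebra_witt] two_cocycle_add[OF lie_superalgebra_witt]
  fix u v w :: witt_H2
  show "u + v + w = u + (v + w)"
    by transfer (simp add: cohomologous_def refl cl algebra_simps)
  show "u + v = v + u"
    by transfer (simp add: cohomologous_def refl cl algebra_simps)
  show "0 + u = u"
    by transfer (simp add: cohomologous_def refl cl)
  show "- u + u = 0"
    by transfer (simp add: cohomologous_def refl cl)
  show "u - v = u + - v" by (simp add: minus_witt_H2_def)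
qed

end

lift_definition witt_H2_scl :: "complex \<Rightarrow> witt_H2 \<Rightarrow> witt_H2" is "\<lambda>c b x y. c * b x y"
  by (rule cohomologous_scale)

lemma vector_space_witt_H2: "vector_space witt_H2_scl"
proof
  have refl: "two_coboundary witt_alg (\<lambda>_ _. 0)"
    by (rule two_coboundary_zero[OF lie_superalgebra_witt])
  note cl = two_cocycle_scale[OF lie_superalgebra_witt] two_cocycle_add[OF lie_superalgebra_witt]
  fix a b :: complex and u v :: witt_H2
  show "witt_H2_scl a (u + v) = witt_H2_scl a u + witt_H2_scl a v"
    by transfer (simp add: cohomologous_def refl cl algebra_simps)
  show "witt_H2_scl (a + b) u = witt_H2_scl a u + witt_H2_scl b u"
    by transfer (simp add: cohomologous_def refl cl algebra_simps)
  show "witt_H2_scl a (witt_H2_scl b u) = witt_H2_scl (a * b) u"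
    by transfer (simp add: cohomologous_def refl cl algebra_simps)
  show "witt_H2_scl 1 u = u"
    by transfer (simp add: cohomologous_def refl cl)
qed


section \<open>The Neveu--Schwarz relations\<close>

text \<open>\<open>G k\<close> stands for $G_{k + 1/2}$, so $G_m^\star = G_{-m}$ reads \<open>st (G k) = G (- k - 1)\<close>,
  and $m + n$ for $m = k + 1/2$, $n = l + 1/2$ is \<open>k + l + 1\<close>.\<close>

definition neveu_schwarz_basis ::
    "('e::ab_group_add) salgebra \<Rightarrow> ('e \<Rightarrow> witt) \<Rightarrow> ('e \<Rightarrow> 'e)
      \<Rightarrow> (int \<Rightarrow> 'e) \<Rightarrow> (int \<Rightarrow> 'e) \<Rightarrow> 'e \<Rightarrow> bool" where
  "neveu_schwarz_basis E \<pi> st L G C \<longleftrightarrow>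
     central_extension witt_alg E \<pi> C
   \<and> star_structure E st \<and> (\<forall>x. \<pi> (st x) = witt_star (\<pi> x))
   \<and> (\<forall>n. L n \<in> part E 0 \<and> \<pi> (L n) = wittd n)
   \<and> (\<forall>k. G k \<in> part E 1 \<and> \<pi> (G k) = wittg k)
   \<and> \<not> module.dependent (scl E) (range L \<union> range G \<union> {C})
   \<and> module.span (scl E) (range L \<union> range G \<union> {C}) = UNIV
   \<and> (\<forall>n. st (L n) = L (- n)) \<and> (\<forall>k. st (G k) = G (- k - 1))
   \<and> (\<forall>m n. brk E (L m) (L n) = scl E (of_int m - of_int n) (L (m + n))
        + scl E (1 / 12 * (of_int m ^ 3 - of_int m) * (if m + n = 0 then 1 else 0)) C)
   \<and> (\<forall>k n. brk E (G k) (L n) = scl E (half k - of_int n / 2) (G (k + n)))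
   \<and> (\<forall>k l. brk E (G k) (G l) = scl E 2 (L (k + l + 1))
        + scl E (1 / 3 * (half k ^ 2 - 1 / 4) * (if k + l + 1 = 0 then 1 else 0)) C)"

end

(* A cocycle b agrees with the coboundary of f(d_n) = - b(d_0, d_n) / n on every pair of generators
   of nonzero total weight, and the Jacobi identity for (gamma_r, gamma_s, d_{-r-s}) leaves a single
   free parameter on the pairs of total weight 0. An arbitrary central extension becomes a cocycle
   by lifting the generators homogeneously. On an irreducible module of an algebra of countable
   dimension, C acts by a scalar (Dixmier): otherwise every C - c is invertible, and the vectors
   (C - c)^{-1} v for complex c are uncountably many and independent in a space of countable
   dimension. *)

theory Submission
  imports Defs "HOL-Computational_Algebra.Fundamental_Theorem_Algebra"
    "HOL-Analysis.Continuum_Not_Denumerable"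
begin

text \<open>The correcting form also has a value at d_0 to choose. It is spent on making b(d_1,
  d_{-1}) vanish, which removes the part of the even diagonal that is linear in the weight and
  leaves the cubic m^3 - m. Then gamma_{1/2} and gamma_{-1/2} pair to zero as well, and the Jacobi
  identities involving one of them express both diagonals through one value; this forces the ratio
  of 1/12 to 1/3. Parity shapes the statements: \<open>trivial_extension\<close> asks for an even
  splitting, while \<open>two_coboundary\<close> admits every linear form, so the classification
  delivers a form that vanishes on odd generators. The cocycle of a projective representation is k
  times the Neveu-Schwarz one plus a coboundary; scalar shifts of the operators absorb the
  coboundary, and k becomes the central charge. Modules come without a bound on their dimension, and
  irreducibility concerns graded subspaces only. Countable dimension and the invertibility of C - c
  therefore come from graded submodules: the span of words applied to a homogeneous vector, and the
  kernels and images of C - c.\<close>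

abbreviation gvec :: "gen \<Rightarrow> witt" where
  "gvec i \<equiv> Poly_Mapping.single i 1"

lemma scl_witt_alg [simp]: "scl witt_alg = witt_scl"
  and brk_witt_alg [simp]: "brk witt_alg = witt_brk"
  by (simp_all add: witt_alg_def)

lemma in_part_witt_alg:
  "x \<in> part witt_alg p \<longleftrightarrow> (\<forall>i\<in>Poly_Mapping.keys x. gen_parity i = p)"
  by (simp add: witt_alg_def)

lemma gvec_in_part [simp]: "gvec i \<in> part witt_alg p \<longleftrightarrow> gen_parity i = p"
  by (simp add: in_part_witt_alg)

section \<open>Linear extension from the generators\<close>

text \<open>The scalar multiplication of the target is an argument because the same construction
  serves for linear forms on the Witt superalgebra and for linear sections of an extension.\<close>

definition lin_ext :: "(complex \<Rightarrow> 'v \<Rightarrow> 'v) \<Rightarrow> (gen \<Rightarrow> 'v::ab_group_add) \<Rightarrow> witt \<Rightarrow> 'v" where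
  "lin_ext s h x = (\<Sum>i\<in>Poly_Mapping.keys x. s (Poly_Mapping.lookup x i) (h i))"

lemma lin_ext_superset:
  assumes "vector_space s" "finite S" "Poly_Mapping.keys x \<subseteq> S"
  shows "lin_ext s h x = (\<Sum>i\<in>S. s (Poly_Mapping.lookup x i) (h i))"
proof -
  interpret vector_space s by fact
  show ?thesis
    unfolding lin_ext_def using assms by (intro sum.mono_neutral_left) (auto simp: in_keys_iff)
qed

lemma linear_lin_ext:
  assumes "vector_space s"
  shows "Vector_Spaces.linear witt_scl s (lin_ext s h)"
  unfolding Vector_Spaces.linear_iff
proof (intro conjI allI assms vector_space_witt)
  interpret vector_space s by fact
  fix x y :: witt and c
  let ?S = "Poly_Mapping.keys x \<union> Poly_Mapping.keys y"
  have *: "finite ?S" "Poly_Mapping.keys (x + y) \<subseteq> ?S" "Poly_Mapping.keys x \<subseteq> ?S" "Poly_Mapping.keys y \<subseteq> ?S"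
    using keys_add[of x y] by auto
  show "lin_ext s h (x + y) = lin_ext s h x + lin_ext s h y"
    by (simp add: lin_ext_superset[OF assms *(1,2)] lin_ext_superset[OF assms *(1,3)]
        lin_ext_superset[OF assms *(1,4)] lookup_add scale_left_distrib sum.distrib)
  show "lin_ext s h (witt_scl c x) = s c (lin_ext s h x)"
    unfolding lin_ext_superset[OF assms finite_keys keys_witt_scl]
    by (simp add: lin_ext_def scale_sum_right)
qed

lemmas lin_ext_add = linear_lin_ext[unfolded Vector_Spaces.linear_iff, THEN conjunct2,
    THEN conjunct2, THEN conjunct1, rule_format]
lemmas lin_ext_scl = linear_lin_ext[unfolded Vector_Spaces.linear_iff, THEN conjunct2,
    THEN conjunct2, THEN conjunct2, rule_format]

lemma lin_ext_single:
  assumes "vector_space s"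
  shows "lin_ext s h (Poly_Mapping.single i c) = s c (h i)"
proof -
  interpret vector_space s by fact
  show ?thesis
    by (subst lin_ext_superset[OF assms, of "{i}"]) (auto simp: lookup_single)
qed

lemma lin_ext_gvec: "vector_space s \<Longrightarrow> lin_ext s h (gvec i) = h i"
  by (simp add: lin_ext_single vector_space.vector_space_assms(4))

lemma linear_eq_on_gens:
  assumes f: "Vector_Spaces.linear witt_scl s f" and g: "Vector_Spaces.linear witt_scl s g"
    and eq: "\<And>i. i \<in> Poly_Mapping.keys x \<Longrightarrow> f (gvec i) = g (gvec i)"
  shows "f x = g x"
proof -
  interpret F: Vector_Spaces.linear witt_scl s f by (rule f)
  interpret G: Vector_Spaces.linear witt_scl s g by (rule g)
  have "f (\<Sum>i\<in>Poly_Mapping.keys x. witt_scl (Poly_Mapping.lookup x i) (gvec i))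
    = g (\<Sum>i\<in>Poly_Mapping.keys x. witt_scl (Poly_Mapping.lookup x i) (gvec i))"
    unfolding F.sum G.sum F.scale G.scale using eq by simp
  then show ?thesis
    using witt_expansion[of x] by simp
qed

text \<open>Agreement is asked only on generators in the support of \<open>x\<close>. For
  homogeneous \<open>x\<close> these all share the parity of \<open>x\<close>, so identities with
  signs can be checked generator by generator.\<close>

lemma witt_eq_on_gensI:
  assumes "vector_space s"
    and "\<And>x y. f (x + y) = f x + f y" "\<And>c x. f (witt_scl c x) = s c (f x)"
    and "\<And>x y. g (x + y) = g x + g y" "\<And>c x. g (witt_scl c x) = s c (g x)"
    and "\<And>i. i \<in> Poly_Mapping.keys x \<Longrightarrow> f (gvec i) = g (gvec i)"
  shows "f x = g x"
  by (rule linear_eq_on_gens[of s])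
     (use assms vector_space_witt in \<open>auto simp: Vector_Spaces.linear_iff\<close>)

lemma bilinear_formD:
  assumes "bilinear_form witt_alg b"
  shows "b (x + x') y = b x y + b x' y" "b x (y + y') = b x y + b x y'"
    "b (witt_scl c x) y = c * b x y" "b x (witt_scl c y) = c * b x y"
  using assms by (auto simp: bilinear_form_def Vector_Spaces.linear_iff)

lemma bilinear_form_single:
  assumes "bilinear_form witt_alg b"
  shows "b (Poly_Mapping.single i c) (Poly_Mapping.single j d) = c * d * b (gvec i) (gvec j)"
  using bilinear_formD(3)[OF assms, of c "gvec i"] bilinear_formD(4)[OF assms, of "gvec i" d "gvec j"]
  by simp

lemma bilinear_form_eq_on_gens:
  assumes b: "bilinear_form witt_alg b" and b': "bilinear_form witt_alg b'"
    and eq: "\<And>i j. b (gvec i) (gvec j) = b' (gvec i) (gvec j)"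
  shows "b = b'"
proof (intro ext)
  fix x y
  show "b x y = b' x y"
  proof (rule witt_eq_on_gensI[OF vector_space_complex, of "\<lambda>x. b x y" "\<lambda>x. b' x y"])
    fix i
    show "b (gvec i) y = b' (gvec i) y"
      by (rule witt_eq_on_gensI[OF vector_space_complex])
         (simp_all add: bilinear_formD[OF b] bilinear_formD[OF b'] eq)
  qed (simp_all add: bilinear_formD[OF b] bilinear_formD[OF b'])
qed

definition bilin_ext :: "(gen \<Rightarrow> gen \<Rightarrow> complex) \<Rightarrow> witt \<Rightarrow> witt \<Rightarrow> complex" where
  "bilin_ext w x y = lin_ext (*) (\<lambda>i. lin_ext (*) (w i) y) x"

lemma bilin_ext_gvec [simp]: "bilin_ext w (gvec i) (gvec j) = w i j"
  by (simp add: bilin_ext_def lin_ext_gvec vector_space_complex)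

lemma bilinear_form_bilin_ext: "bilinear_form witt_alg (bilin_ext w)"
  unfolding bilinear_form_def
proof (intro conjI allI)
  note V = vector_space_complex
  fix y
  show "Vector_Spaces.linear (scl witt_alg) (*) (\<lambda>x. bilin_ext w x y)"
    using linear_lin_ext[OF V] by (simp add: bilin_ext_def)
  show "Vector_Spaces.linear (scl witt_alg) (*) (bilin_ext w y)"
    using vector_space_witt V
    by (simp add: bilin_ext_def Vector_Spaces.linear_iff lin_ext_add[OF V] lin_ext_scl[OF V])
       (simp add: lin_ext_def sum.distrib sum_distrib_left algebra_simps)
qed

lemma bilinear_form_coboundary:
  assumes "Vector_Spaces.linear witt_scl (*) f"
  shows "bilinear_form witt_alg (\<lambda>x y. f (witt_brk x y))"
  using assms
  by (simp add: bilinear_form_def Vector_Spaces.linear_iff witt_brk_add_left witt_brk_add_right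
      witt_brk_scl_left witt_brk_scl_right)

text \<open>For fixed parities \<open>ksign p q\<close> is a constant, so each identity is linear in
  every variable separately. The variables are reduced one at a time to generators in the support,
  which have the parity of the element they come from.\<close>

lemma two_cocycle_wittI:
  assumes b: "bilinear_form witt_alg b"
    and par: "\<And>i j. gen_parity i + gen_parity j \<noteq> 0 \<Longrightarrow> b (gvec i) (gvec j) = 0"
    and sk: "\<And>i j. b (gvec i) (gvec j)
      = - ksign (gen_parity i) (gen_parity j) * b (gvec j) (gvec i)"
    and jac: "\<And>i j k. b (gvec i) (gen_brk j k) = b (gen_brk i j) (gvec k)
      + ksign (gen_parity i) (gen_parity j) * b (gvec j) (gen_brk i k)"
  shows "two_cocycle witt_alg b"
  unfolding two_cocycle_iff[OF lie_superalgebra_witt]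
proof (intro conjI allI ballI impI b)
  note V = vector_space_complex
  note lin = bilinear_formD[OF b] witt_brk_add_left witt_brk_add_right witt_brk_scl_left
    witt_brk_scl_right algebra_simps
  fix p q x y assume "x \<in> part witt_alg p" "y \<in> part witt_alg q"
  then have x: "\<And>i. i \<in> Poly_Mapping.keys x \<Longrightarrow> gen_parity i = p"
    and y: "\<And>i. i \<in> Poly_Mapping.keys y \<Longrightarrow> gen_parity i = q" by (auto simp: in_part_witt_alg)
  show "b x y = - ksign p q * b y x"
  proof (rule witt_eq_on_gensI[OF V, of "\<lambda>x. b x y" "\<lambda>x. - ksign p q * b y x"])
    fix i assume i: "i \<in> Poly_Mapping.keys x"
    show "b (gvec i) y = - ksign p q * b y (gvec i)"
    proof (rule witt_eq_on_gensI[OF V, of "b (gvec i)"])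
      fix j assume j: "j \<in> Poly_Mapping.keys y"
      show "b (gvec i) (gvec j) = - ksign p q * b (gvec j) (gvec i)"
        using sk[of i j] x[OF i] y[OF j] by simp
    qed (simp_all add: lin)
  qed (simp_all add: lin)
  assume pq: "p + q \<noteq> 0"
  show "b x y = 0"
  proof (rule witt_eq_on_gensI[OF V, of "\<lambda>x. b x y" "\<lambda>x. 0"])
    fix i assume i: "i \<in> Poly_Mapping.keys x"
    show "b (gvec i) y = 0"
    proof (rule witt_eq_on_gensI[OF V, of "b (gvec i)" "\<lambda>x. 0"])
      fix j assume j: "j \<in> Poly_Mapping.keys y"
      show "b (gvec i) (gvec j) = 0"
        using par[of i j] x[OF i] y[OF j] pq by blast
    qed (simp_all add: lin)
  qed (simp_all add: lin)
next
  note V = vector_space_complex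
  note lin = bilinear_formD[OF b] witt_brk_add_left witt_brk_add_right witt_brk_scl_left
    witt_brk_scl_right algebra_simps
  fix p q r x y z
  assume "x \<in> part witt_alg p" "y \<in> part witt_alg q" "z \<in> part witt_alg r"
  then have x: "\<And>i. i \<in> Poly_Mapping.keys x \<Longrightarrow> gen_parity i = p"
    and y: "\<And>i. i \<in> Poly_Mapping.keys y \<Longrightarrow> gen_parity i = q" by (auto simp: in_part_witt_alg)
  have "b x (witt_brk y z) = b (witt_brk x y) z + ksign p q * b y (witt_brk x z)"
  proof (rule witt_eq_on_gensI[OF V, of "\<lambda>x. b x (witt_brk y z)"
        "\<lambda>x. b (witt_brk x y) z + ksign p q * b y (witt_brk x z)"])
    fix i assume i: "i \<in> Poly_Mapping.keys x"
    show "b (gvec i) (witt_brk y z)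
      = b (witt_brk (gvec i) y) z + ksign p q * b y (witt_brk (gvec i) z)"
    proof (rule witt_eq_on_gensI[OF V, of "\<lambda>y. b (gvec i) (witt_brk y z)"
        "\<lambda>y. b (witt_brk (gvec i) y) z + ksign p q * b y (witt_brk (gvec i) z)"])
      fix j assume j: "j \<in> Poly_Mapping.keys y"
      show "b (gvec i) (witt_brk (gvec j) z)
        = b (witt_brk (gvec i) (gvec j)) z + ksign p q * b (gvec j) (witt_brk (gvec i) z)"
      proof (rule witt_eq_on_gensI[OF V, of "\<lambda>z. b (gvec i) (witt_brk (gvec j) z)"
          "\<lambda>z. b (witt_brk (gvec i) (gvec j)) z + ksign p q * b (gvec j) (witt_brk (gvec i) z)"])
        fix k
        show "b (gvec i) (witt_brk (gvec j) (gvec k)) = b (witt_brk (gvec i) (gvec j)) (gvec k)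
          + ksign p q * b (gvec j) (witt_brk (gvec i) (gvec k))"
          using jac[of i j k] x[OF i] y[OF j] by simp
      qed (simp_all add: lin)
    qed (simp_all add: lin)
  qed (simp_all add: lin)
  then show "b x (brk witt_alg y z) = b (brk witt_alg x y) z + ksign p q * b y (brk witt_alg x z)"
    by simp
qed

section \<open>The Neveu--Schwarz cocycle\<close>

fun ns_gen :: "gen \<Rightarrow> gen \<Rightarrow> complex" where
  "ns_gen (Dgen m) (Dgen n) = 1 / 12 * (of_int m ^ 3 - of_int m) * (if m + n = 0 then 1 else 0)"
| "ns_gen (Ggen k) (Ggen l) = 1 / 3 * (half k ^ 2 - 1 / 4) * (if k + l + 1 = 0 then 1 else 0)"
| "ns_gen (Dgen m) (Ggen k) = 0"
| "ns_gen (Ggen k) (Dgen m) = 0"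

definition ns_cocycle :: "witt \<Rightarrow> witt \<Rightarrow> complex" where
  "ns_cocycle = bilin_ext ns_gen"

lemma bilinear_form_ns_cocycle: "bilinear_form witt_alg ns_cocycle"
  by (simp add: ns_cocycle_def bilinear_form_bilin_ext)

lemma ns_cocycle_gvec [simp]: "ns_cocycle (gvec i) (gvec j) = ns_gen i j"
  by (simp add: ns_cocycle_def)

lemma ns_cocycle_single_left:
    "ns_cocycle (Poly_Mapping.single i c) (gvec j) = c * ns_gen i j"
  and ns_cocycle_single_right:
    "ns_cocycle (gvec i) (Poly_Mapping.single j c) = c * ns_gen i j"
  using bilinear_form_single[OF bilinear_form_ns_cocycle, of i _ j] by auto

lemma ns_gen_skew: "ns_gen i j = - ksign (gen_parity i) (gen_parity j) * ns_gen j i"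
proof (cases i; cases j)
  fix m n assume ij: "i = Dgen m" "j = Dgen n"
  show ?thesis
  proof (cases "n = - m")
    case True
    show ?thesis unfolding ij True by (simp add: ksign_def)
  qed (auto simp: ij)
next
  fix k l assume ij: "i = Ggen k" "j = Ggen l"
  show ?thesis
  \<comment> \<open>The index \<open>- k - 1\<close> encodes the half-integer
    \<open>- half k\<close>, which has the same square; this is why the odd values are
    symmetric.\<close>
  proof (cases "l = - k - 1")
    case True
    show ?thesis unfolding ij True
      by (simp add: ksign_def half_def power2_eq_square algebra_simps)
  qed (auto simp: ij)
qed (simp_all add: ksign_def)

text \<open>Brackets add weights, and \<open>ns_gen\<close> lives on pairs of equal parity and total
  weight 0. Hence every term vanishes unless the three weights add up to 0 and an even number of
  generators is odd. In the remaining cases the third index is eliminated, which leaves a polynomial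
  identity in two integers.\<close>

lemma ns_gen_jacobi:
  "ns_cocycle (gvec i) (gen_brk j k) = ns_cocycle (gen_brk i j) (gvec k)
    + ksign (gen_parity i) (gen_parity j) * ns_cocycle (gvec j) (gen_brk i k)"
proof -
  note S = ns_cocycle_single_left ns_cocycle_single_right ksign_def half_def
  consider (DDD) m n l where "i = Dgen m" "j = Dgen n" "k = Dgen l"
    | (DGG) m n l where "i = Dgen m" "j = Ggen n" "k = Ggen l"
    | (GDG) m n l where "i = Ggen m" "j = Dgen n" "k = Ggen l"
    | (GGD) m n l where "i = Ggen m" "j = Ggen n" "k = Dgen l"
    | (odd) "gen_parity i + gen_parity j + gen_parity k = 1"
    by (cases i; cases j; cases k) auto
  then show ?thesis
  proof cases
    case DDD
    show ?thesis
    proof (cases "m + n + l = 0")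
      case True
      then have l: "l = - m - n" by simp
      show ?thesis unfolding DDD l by (simp add: S) algebra
    qed (simp add: DDD S add.assoc add.left_commute)
  next
    case DGG
    show ?thesis
    proof (cases "m + n + l + 1 = 0")
      case True
      then have l: "l = - m - n - 1" by simp
      show ?thesis unfolding DGG l by (simp add: S field_simps) algebra
    qed (simp add: DGG S add.assoc add.left_commute)
  next
    case GDG
    show ?thesis
    proof (cases "m + n + l + 1 = 0")
      case True
      then have l: "l = - m - n - 1" by simp
      show ?thesis unfolding GDG l by (simp add: S field_simps) algebra
    qed (simp add: GDG S add.assoc add.left_commute)
  next
    case GGD
    show ?thesis
    proof (cases "m + n + l + 1 = 0")
      case True
      then have l: "l = - m - n - 1" by simp
      show ?thesis unfolding GGD l by (simp add: S field_simps) algebra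
    qed (simp add: GGD S add.assoc add.left_commute)
  next
    case odd
    then show ?thesis by (cases i; cases j; cases k) (simp_all add: S)
  qed
qed

lemma two_cocycle_ns_cocycle: "two_cocycle witt_alg ns_cocycle"
proof (rule two_cocycle_wittI[OF bilinear_form_ns_cocycle])
  fix i j assume "gen_parity i + gen_parity j \<noteq> 0"
  then show "ns_cocycle (gvec i) (gvec j) = 0" by (cases i; cases j) simp_all
next
  show "ns_cocycle (gvec i) (gvec j)
    = - ksign (gen_parity i) (gen_parity j) * ns_cocycle (gvec j) (gvec i)" for i j
    unfolding ns_cocycle_gvec by (rule ns_gen_skew)
qed (rule ns_gen_jacobi)

text \<open>On the pair d_n, d_{-n} a coboundary equals 2 n f(d_0), which is linear in n, whereas
  the cocycle is a multiple of n^3 - n. The values at n = 1 and n = 2 already contradict each other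
  unless \<open>c\<close> is 0.\<close>

lemma ns_cocycle_not_coboundary:
  assumes "two_coboundary witt_alg (\<lambda>x y. c * ns_cocycle x y)"
  shows "c = 0"
proof -
  obtain f where f: "Vector_Spaces.linear witt_scl (*) f"
    "\<And>x y. c * ns_cocycle x y = f (witt_brk x y)"
    using assms by (auto simp: two_coboundary_def)
  have fs: "f (Poly_Mapping.single (Dgen 0) a) = a * f (gvec (Dgen 0))" for a
    using f(1) unfolding Vector_Spaces.linear_iff
    by (metis mult.right_neutral witt_scl_single)
  have "c * ns_cocycle (gvec (Dgen n)) (gvec (Dgen (- n))) = 2 * of_int n * f (gvec (Dgen 0))" for n
    unfolding f(2) using fs[of "2 * of_int n"] by simp
  from this[of 1] this[of 2] show ?thesis by simp
qed

section \<open>Classification of the scalar two-cocycles\<close>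

lemma two_cocycleD:
  assumes "two_cocycle witt_alg b"
  shows "bilinear_form witt_alg b"
    and "gen_parity i + gen_parity j \<noteq> 0 \<Longrightarrow> b (gvec i) (gvec j) = 0"
    and "b (gvec i) (gvec j) = - ksign (gen_parity i) (gen_parity j) * b (gvec j) (gvec i)"
    and "b (gvec i) (gen_brk j k) = b (gen_brk i j) (gvec k)
      + ksign (gen_parity i) (gen_parity j) * b (gvec j) (gen_brk i k)"
proof -
  note R = assms[unfolded two_cocycle_iff[OF lie_superalgebra_witt]]
  have P: "gvec i \<in> part witt_alg (gen_parity i)" for i by simp
  show "bilinear_form witt_alg b" using R by (rule conjunct1)
  show "gen_parity i + gen_parity j \<noteq> 0 \<Longrightarrow> b (gvec i) (gvec j) = 0"
    using R P by blast
  show "b (gvec i) (gvec j) = - ksign (gen_parity i) (gen_parity j) * b (gvec j) (gvec i)"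
    using R P by blast
  have "b (gvec i) (brk witt_alg (gvec j) (gvec k)) = b (brk witt_alg (gvec i) (gvec j)) (gvec k)
      + ksign (gen_parity i) (gen_parity j) * b (gvec j) (brk witt_alg (gvec i) (gvec k))"
    using R P by blast
  then show "b (gvec i) (gen_brk j k) = b (gen_brk i j) (gvec k)
      + ksign (gen_parity i) (gen_parity j) * b (gvec j) (gen_brk i k)"
    by simp
qed

text \<open>The central element is even, so a map sending \<open>x\<close> to
  \<open>(x, f x)\<close> respects parity exactly when \<open>f\<close> kills the odd part.\<close>

lemma even_form_odd_part:
  assumes f: "Vector_Spaces.linear witt_scl (*) f" "\<And>k. f (gvec (Ggen k)) = 0"
    and x: "x \<in> part witt_alg 1"
  shows "f x = 0"
proof (rule linear_eq_on_gens[OF f(1), of "\<lambda>_. 0"])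
  fix i assume "i \<in> Poly_Mapping.keys x"
  then have "gen_parity i = 1" using x by (auto simp: in_part_witt_alg)
  then show "f (gvec i) = 0" using f(2) by (cases i) auto
qed (simp add: Vector_Spaces.linear_iff vector_space_witt vector_space_complex)

text \<open>Skew symmetry and the Jacobi identity are the images under \<open>f\<close> of those of
  the algebra. The parity condition is where \<open>odd\<close> enters: the bracket of an even and
  an odd generator is odd.\<close>

lemma two_cocycle_coboundary:
  assumes f: "Vector_Spaces.linear witt_scl (*) f" and odd: "\<And>k. f (gvec (Ggen k)) = 0"
  shows "two_cocycle witt_alg (\<lambda>x y. f (witt_brk x y))"
proof (rule two_cocycle_wittI[OF bilinear_form_coboundary[OF f]])
  interpret Vector_Spaces.linear witt_scl "(*)" f by (rule f)
  have fs: "f (Poly_Mapping.single (Ggen k) c) = 0" for k c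
    using scale[of c "gvec (Ggen k)"] odd[of k] by simp
  fix i j k
  show "gen_parity i + gen_parity j \<noteq> 0 \<Longrightarrow> f (witt_brk (gvec i) (gvec j)) = 0"
    by (cases i; cases j) (simp_all add: fs)
  show "f (witt_brk (gvec i) (gvec j))
    = - ksign (gen_parity i) (gen_parity j) * f (witt_brk (gvec j) (gvec i))"
    unfolding witt_brk_single using gen_skew[of i j] scale by metis
  show "f (witt_brk (gvec i) (gen_brk j k)) = f (witt_brk (gen_brk i j) (gvec k))
    + ksign (gen_parity i) (gen_parity j) * f (witt_brk (gvec j) (gen_brk i k))"
    unfolding gen_jacobi[of i j k] by (simp add: add scale)
qed

lemma half_square: "half k ^ 2 - 1 / 4 = of_int k * (of_int k + 1)"
  by (simp add: half_def power2_eq_square algebra_simps)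

text \<open>A cocycle vanishing on $d_0$ is supported on pairs of opposite weight, because $d_0$ acts
  semisimply. The Jacobi identity for two odd generators and one even generator then ties its
  values on the two diagonals together, which fixes them up to one scalar.\<close>

lemma normalized_cocycle:
  assumes b: "two_cocycle witt_alg b"
    and d0: "\<And>n. b (gvec (Dgen 0)) (gvec (Dgen n)) = 0"
    and d1: "b (gvec (Dgen 1)) (gvec (Dgen (- 1))) = 0"
  shows "\<exists>k. b = (\<lambda>x y. k * ns_cocycle x y)"
proof -
  note bl = two_cocycleD(1)[OF b] and par = two_cocycleD(2)[OF b]
    and sk = two_cocycleD(3)[OF b] and jac = two_cocycleD(4)[OF b]
  define B where "B i j = b (gvec i) (gvec j)" for i j
  have S: "b (Poly_Mapping.single i c) (Poly_Mapping.single j d) = c * d * B i j" for i j c d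
    unfolding B_def by (rule bilinear_form_single[OF bl])
  have d0: "B (Dgen 0) (Dgen n) = 0" for n using d0 by (simp add: B_def)
  have d1: "B (Dgen 1) (Dgen (- 1)) = 0" using d1 by (simp add: B_def)
  have evens: "B (Dgen m) (Dgen n) = 0" if "m + n \<noteq> 0" for m n
  proof -
    have "of_int m * B (Dgen m) (Dgen n) + of_int n * B (Dgen m) (Dgen n) = 0"
      using jac[of "Dgen 0" "Dgen m" "Dgen n"] by (simp add: S d0 ksign_def) algebra
    then have "(of_int m + of_int n) * B (Dgen m) (Dgen n) = 0" unfolding distrib_right .
    moreover have "(of_int m + of_int n :: complex) \<noteq> 0" using that by (metis of_int_0_eq_iff of_int_add)
    ultimately show ?thesis by simp
  qed
  have odds: "B (Ggen m) (Ggen n) = 0" if "m + n + 1 \<noteq> 0" for m n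
  proof -
    have "half m * B (Ggen m) (Ggen n) + half n * B (Ggen m) (Ggen n) = 0"
      using jac[of "Dgen 0" "Ggen m" "Ggen n"] by (simp add: S d0 ksign_def) algebra
    then have "(half m + half n) * B (Ggen m) (Ggen n) = 0" unfolding distrib_right .
    moreover have "half m + half n = of_int m + of_int n + 1" by (simp add: half_def)
    moreover have "(of_int m + of_int n + 1 :: complex) \<noteq> 0"
      using that by (metis of_int_0_eq_iff of_int_1 of_int_add)
    ultimately show ?thesis by simp
  qed
  define \<phi> where "\<phi> n = B (Dgen n) (Dgen (- n))" for n
  define \<psi> where "\<psi> k = B (Ggen k) (Ggen (- k - 1))" for k
  have \<phi>_neg: "\<phi> (- n) = - \<phi> n" for n
    using sk[of "Dgen (-n)" "Dgen n"] by (simp add: \<phi>_def ksign_def S)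
  have \<psi>_neg: "\<psi> (- k - 1) = \<psi> k" for k
    using sk[of "Ggen (- k - 1)" "Ggen k"] by (simp add: \<psi>_def ksign_def S)
  \<comment> \<open>The even index \<open>- (k + l + 1)\<close> brings the total weight to 0, so all
    terms of this Jacobi identity lie on the two diagonals.\<close>
  have rel: "(half l - of_int (- (k + l + 1)) / 2) * \<psi> k
      + (half k - of_int (- (k + l + 1)) / 2) * \<psi> l = 2 * \<phi> (k + l + 1)" for k l
  proof -
    have "l + - (k + l + 1) = - k - 1" "k + - (k + l + 1) = - l - 1" by simp_all
    then show ?thesis
      using jac[of "Ggen k" "Ggen l" "Dgen (- (k + l + 1))"]
      unfolding gen_brk.simps S \<phi>_def \<psi>_def
      by (simp only: ksign_def gen_parity.simps simp_thms if_True mult_1_left mult_1_right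
          mult_minus_left diff_add_cancel add_uminus_conv_diff)
  qed
  have \<phi>1: "\<phi> 1 = 0" using d1 by (simp add: \<phi>_def)
  \<comment> \<open>The bracket of gamma_{1/2} with itself is 2 d_1, which transfers the
    normalisation at d_1 to the odd diagonal.\<close>
  have \<psi>0: "\<psi> 0 = 0" using rel[of 0 0] \<phi>1 by (simp add: half_def)
  \<comment> \<open>Taking gamma_{1/2} and then gamma_{-1/2} as first generator, where the odd
    diagonal vanishes, gives \<open>up\<close> and \<open>down\<close>. Eliminating
    \<open>\<psi>\<close> leaves the recursion (n - 1) \<phi>(n + 1) = (n + 2) \<phi>(n), which n^3
    - n solves.\<close>
  have up: "(of_int k + 2) * \<psi> k = 4 * \<phi> (k + 1)" for k
    using rel[of 0 k] \<psi>0 by (simp add: half_def field_simps)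
  have down: "(of_int k - 1) * \<psi> k = 4 * \<phi> k" for k
  proof -
    have "2 * ((of_int k - 1) * \<psi> k) = 2 * (4 * \<phi> k)"
      using rel[of "-1" k] \<psi>_neg[of 0] \<psi>0 by (simp add: half_def field_simps)
    then show ?thesis unfolding mult_cancel_left by simp
  qed
  \<comment> \<open>The denominator is 2^3 - 2, the value of the cubic at 2.\<close>
  have \<phi>_nat: "\<phi> (int n) = \<phi> 2 / 6 * (of_nat n ^ 3 - of_nat n)" for n
  proof (induction n)
    case 0
    show ?case using \<phi>_neg[of 0] by simp
  next
    case (Suc n)
    show ?case
    \<comment> \<open>At n = 1 the recursion degenerates and leaves \<open>\<phi> 2\<close> as the
      free parameter; at n = 0 the claim is the normalisation \<open>\<phi>1\<close>.\<close>
    proof (cases "n = 1 \<or> n = 0")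
      case True
      then show ?thesis using \<phi>1 by auto
    next
      case False
      then have n1: "(of_nat n - 1 :: complex) \<noteq> 0" by (auto simp: right_minus_eq)
      have "(of_nat n - 1) * (4 * \<phi> (int n + 1)) = (of_nat n + 2) * ((of_nat n - 1) * \<psi> (int n))"
        using up[of "int n"] by (simp add: algebra_simps)
      also have "\<dots> = (of_nat n + 2) * (4 * (\<phi> 2 / 6 * (of_nat n ^ 3 - of_nat n)))"
        using down[of "int n"] by (simp only: Suc.IH of_int_of_nat_eq)
      also have "\<dots> = (of_nat n - 1) * (4 * (\<phi> 2 / 6 * (of_nat (Suc n) ^ 3 - of_nat (Suc n))))"
        by (simp add: field_simps power3_eq_cube)
      finally show ?thesis using n1 by (simp add: add.commute mult.commute)
    qed
  qed
  have \<phi>: "\<phi> n = \<phi> 2 / 6 * (of_int n ^ 3 - of_int n)" for n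
  proof (cases "n \<ge> 0")
    case True
    then show ?thesis using \<phi>_nat[of "nat n"] by simp
  next
    case False
    then have "\<phi> (- n) = \<phi> 2 / 6 * (of_int (- n) ^ 3 - of_int (- n))"
      using \<phi>_nat[of "nat (- n)"] by simp
    then have "- \<phi> n = - (\<phi> 2 / 6 * (of_int n ^ 3 - of_int n))"
      unfolding \<phi>_neg by (simp add: algebra_simps)
    then show ?thesis by simp
  qed
  have \<psi>: "\<psi> k = 2 * \<phi> 2 / 3 * (of_int k * (of_int k + 1))" for k
  \<comment> \<open>\<open>down\<close> determines \<open>\<psi> k\<close> except at k = 1, where
    \<open>up\<close> gives 3 \<psi>(1) = 4 \<phi>(2).\<close>
  proof (cases "k = 1")
    case True
    then show ?thesis using up[of 1] by (simp add: field_simps)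
  next
    case False
    then have "(of_int k - 1 :: complex) \<noteq> 0"
      by (metis eq_iff_diff_eq_0 of_int_1 of_int_eq_iff)
    moreover have "(of_int k - 1) * \<psi> k
        = (of_int k - 1) * (2 * \<phi> 2 / 3 * (of_int k * (of_int k + 1)))"
      unfolding down[of k] \<phi>[of k] by (simp add: field_simps power3_eq_cube)
    ultimately show ?thesis by simp
  qed
  \<comment> \<open>The factor 2 appears because \<open>ns_cocycle\<close> takes the value 1/2 on
    the pair d_2, d_{-2}.\<close>
  have "b = (\<lambda>x y. 2 * \<phi> 2 * ns_cocycle x y)"
  proof (rule bilinear_form_eq_on_gens[OF bl])
    show "bilinear_form witt_alg (\<lambda>x y. 2 * \<phi> 2 * ns_cocycle x y)"
      by (rule bilinear_form_scale[OF bilinear_form_ns_cocycle])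
    fix i j
    consider (DD) m n where "i = Dgen m" "j = Dgen n" | (GG) m n where "i = Ggen m" "j = Ggen n"
      | (odd) "gen_parity i + gen_parity j \<noteq> 0" "ns_gen i j = 0"
      by (cases i; cases j) auto
    then show "b (gvec i) (gvec j) = 2 * \<phi> 2 * ns_cocycle (gvec i) (gvec j)"
    proof cases
      case DD
      show ?thesis
      proof (cases "m + n = 0")
        case True
        then have n: "n = - m" by simp
        show ?thesis
          unfolding DD n using \<phi>[of m, unfolded \<phi>_def[of m]] by (simp add: S)
      qed (simp add: DD S evens)
    next
      case GG
      show ?thesis
      proof (cases "m + n + 1 = 0")
        case True
        then have n: "n = - m - 1" by simp
        show ?thesis
          unfolding GG n using \<psi>[of m, unfolded \<psi>_def[of m]]
          by (simp add: S half_square)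
      qed (simp add: GG S odds)
    next
      case odd
      show ?thesis using par[OF odd(1)] odd(2) by (simp only: ns_cocycle_gvec mult_zero_right)
    qed
  qed
  then show ?thesis by blast
qed

lemma cocycle_classification:
  assumes b: "two_cocycle witt_alg b"
  obtains k f where "Vector_Spaces.linear witt_scl (*) f" "\<And>n. f (gvec (Ggen n)) = 0"
    "b = (\<lambda>x y. k * ns_cocycle x y + f (witt_brk x y))"
proof -
  note bl = two_cocycleD(1)[OF b] and sk = two_cocycleD(3)[OF b]
  \<comment> \<open>At d_0, where division by the weight is impossible, the value comes from
    [d_1, d_{-1}] = 2 d_0.\<close>
  define h where "h i = (case i of Ggen _ \<Rightarrow> 0
    | Dgen n \<Rightarrow> if n = 0 then b (gvec (Dgen 1)) (gvec (Dgen (- 1))) / 2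
        else - b (gvec (Dgen 0)) (gvec (Dgen n)) / of_int n)" for i
  define f where "f = lin_ext (*) h"
  have f: "Vector_Spaces.linear witt_scl (*) f"
    unfolding f_def by (rule linear_lin_ext[OF vector_space_complex])
  have fs: "f (Poly_Mapping.single i c) = c * h i" for i c
    by (simp add: f_def lin_ext_single vector_space_complex)
  have f0: "f 0 = 0" using fs[of _ 0] by simp
  have odd: "f (gvec (Ggen n)) = 0" for n by (simp add: fs h_def)
  let ?b = "\<lambda>x y. b x y + (- 1) * f (witt_brk x y)"
  have "two_cocycle witt_alg ?b"
    using two_cocycle_add[OF lie_superalgebra_witt b
        two_cocycle_scale[OF lie_superalgebra_witt two_cocycle_coboundary[OF f odd]]] .
  \<comment> \<open>For n = 0 the bracket is zero, and skew symmetry makes b(d_0, d_0)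
    vanish.\<close>
  moreover have "?b (gvec (Dgen 0)) (gvec (Dgen n)) = 0" for n
    using sk[of "Dgen 0" "Dgen 0"] by (cases "n = 0") (simp_all add: fs f0 h_def ksign_def)
  moreover have "?b (gvec (Dgen 1)) (gvec (Dgen (- 1))) = 0"
    by (simp add: fs h_def)
  ultimately obtain k where "?b = (\<lambda>x y. k * ns_cocycle x y)"
    using normalized_cocycle[of ?b] by blast
  then have "?b x y = k * ns_cocycle x y" for x y by metis
  then have "b = (\<lambda>x y. k * ns_cocycle x y + f (witt_brk x y))"
    by (intro ext) (simp add: algebra_simps)
  then show thesis using that f odd by blast
qed

section \<open>Homomorphisms and equivalence of extensions\<close>

lemma lie_homD:
  assumes "lie_hom A B f"
  shows "f (x + y) = f x + f y" "f (scl A c x) = scl B c (f x)"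
    "x \<in> part A p \<Longrightarrow> f x \<in> part B p" "f (brk A x y) = brk B (f x) (f y)"
    "Vector_Spaces.linear (scl A) (scl B) f"
  using assms by (auto simp: lie_hom_def Vector_Spaces.linear_iff image_subset_iff)

context super_space
begin

lemma part_disjoint:
  assumes "x \<in> part V p" "x \<in> part V q" "p \<noteq> q"
  shows "x = 0"
  using part_inter assms by (cases p; cases q) auto

text \<open>With \<open>p + 1\<close> for the opposite parity, one argument covers even and odd
  elements alike.\<close>

lemma part_decomposition:
  obtains y z where "y \<in> part V p" "z \<in> part V (p + 1)" "x = y + z"
proof -
  obtain y z where "y \<in> part V 0" "z \<in> part V 1" "x = y + z" using part_sum by blast
  then show thesis using that[of y z] that[of z y] by (cases p) (simp_all add: add.commute)
qed

lemma part_sum_unique: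
  assumes "x \<in> part V p" "y \<in> part V p" "z \<in> part V (p + 1)" "x = y + z"
  shows "z = 0"
proof -
  have "z = x - y" using assms by simp
  then have "z \<in> part V p" using subspace_diff[OF subspace_part] assms by blast
  then show ?thesis using part_disjoint[of z p "p + 1"] assms(3) by (cases p) simp_all
qed

end

lemma lie_hom_comp:
  assumes f: "lie_hom A B f" and g: "lie_hom B C g"
  shows "lie_hom A C (g \<circ> f)"
proof -
  have "vector_space (scl A)" "vector_space (scl C)"
    using lie_homD(5)[OF f] lie_homD(5)[OF g] by (simp_all add: Vector_Spaces.linear_iff)
  then show ?thesis
    using lie_homD[OF f] lie_homD[OF g] by (auto simp: lie_hom_def Vector_Spaces.linear_iff)
qed

text \<open>The point that needs an argument is parity. If \<open>y\<close> has parity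
  \<open>p\<close>, the component of \<open>inv f y\<close> of the other parity is mapped into both
  parts of the target, hence to 0, and so it is 0 by injectivity.\<close>

lemma lie_hom_inv:
  assumes f: "lie_hom A B f" and bij: "bij f" and A: "super_space A" and B: "super_space B"
  shows "lie_hom B A (inv f)"
proof -
  interpret A: super_space A by fact
  interpret B: super_space B by fact
  have surj: "f (inv f y) = y" for y using bij by (simp add: bij_is_surj surj_f_inv_f)
  have inj: "inv f y = x \<longleftrightarrow> y = f x" for x y using bij surj by (metis bij_inv_eq_iff)
  have f0: "f 0 = 0" using lie_homD(1)[OF f, of 0 0] by simp
  have "inv f y \<in> part A p" if y: "y \<in> part B p" for p y
  proof -
    obtain u v where uv: "u \<in> part A p" "v \<in> part A (p + 1)" "inv f y = u + v"
      using A.part_decomposition .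
    then have "y = f u + f v" using inj lie_homD(1)[OF f] by simp
    then have "f v = 0" using B.part_sum_unique[OF y] uv lie_homD(3)[OF f] by blast
    then have "v = 0" using inj[of 0 v] inj[of 0 0] f0 by simp
    then show ?thesis using uv by simp
  qed
  moreover have "inv f (brk B x y) = brk A (inv f x) (inv f y)" for x y
    unfolding inj lie_homD(4)[OF f] surj ..
  moreover have "inv f (x + y) = inv f x + inv f y" for x y
    unfolding inj lie_homD(1)[OF f] surj ..
  moreover have "inv f (scl B c x) = scl A c (inv f x)" for c x
    unfolding inj lie_homD(2)[OF f] surj ..
  ultimately show ?thesis
    using A.vector_space_axioms B.vector_space_axioms
    by (auto simp: lie_hom_def Vector_Spaces.linear_iff)
qed

lemma central_extensionD:
  assumes "central_extension A E \<pi> Z"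
  shows "lie_superalgebra A" "lie_superalgebra E" "super_space A" "super_space E" "lie_hom E A \<pi>"
    "surj \<pi>" "\<pi> x = 0 \<longleftrightarrow> (\<exists>c. x = scl E c Z)" "Z \<noteq> 0" "Z \<in> part E 0" "brk E Z x = 0"
  using assms unfolding central_extension_def lie_superalgebra_def by auto

lemma equivalent_extensions_sym:
  assumes E: "super_space E" and F: "super_space F"
    and eq: "equivalent_extensions E \<pi> C F \<rho> D"
  shows "equivalent_extensions F \<rho> D E \<pi> C"
proof -
  obtain f where f: "lie_hom E F f" "bij f" "\<And>x. \<rho> (f x) = \<pi> x" "f C = D"
    using eq by (auto simp: equivalent_extensions_def)
  show ?thesis
    unfolding equivalent_extensions_def
  proof (intro exI[of _ "inv f"] conjI allI)
    show "lie_hom F E (inv f)" using lie_hom_inv[OF f(1,2) E F] .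
    show "bij (inv f)" using f(2) by (rule bij_imp_bij_inv)
    show "\<pi> (inv f x) = \<rho> x" for x
      using f(3)[of "inv f x"] f(2) by (simp add: bij_is_surj surj_f_inv_f)
    show "inv f D = C" using f(2,4) by (auto simp: bij_is_inj)
  qed
qed

lemma equivalent_extensions_trans:
  assumes "equivalent_extensions E \<pi> C F \<rho> D" "equivalent_extensions F \<rho> D H \<sigma> K"
  shows "equivalent_extensions E \<pi> C H \<sigma> K"
proof -
  obtain f where f: "lie_hom E F f" "bij f" "\<And>x. \<rho> (f x) = \<pi> x" "f C = D"
    using assms(1) by (auto simp: equivalent_extensions_def)
  obtain g where g: "lie_hom F H g" "bij g" "\<And>x. \<sigma> (g x) = \<rho> x" "g D = K"
    using assms(2) by (auto simp: equivalent_extensions_def)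
  show ?thesis
    unfolding equivalent_extensions_def
    using lie_hom_comp[OF f(1) g(1)] bij_comp[OF f(2) g(2)] f g by (intro exI[of _ "g \<circ> f"]) simp
qed

lemma equivalent_extensions_rescale:
  assumes "equivalent_extensions E \<pi> C F \<rho> D"
  shows "equivalent_extensions E \<pi> (scl E k C) F \<rho> (scl F k D)"
  using assms lie_homD(2) unfolding equivalent_extensions_def by metis

section \<open>Extensions of the Witt superalgebra as cocycles\<close>

lemma homogeneous_lift:
  assumes ce: "central_extension A E \<pi> Z" and x: "x \<in> part A p"
  shows "\<exists>e\<in>part E p. \<pi> e = x"
proof -
  interpret A: super_space A using central_extensionD[OF ce] by simp
  interpret E: super_space E using central_extensionD[OF ce] by simp
  note hom = lie_homD[OF central_extensionD(5)[OF ce]]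
  obtain e where e: "\<pi> e = x" using central_extensionD(6)[OF ce] by (metis surjD)
  obtain u v where uv: "u \<in> part E p" "v \<in> part E (p + 1)" "e = u + v"
    using E.part_decomposition .
  have "\<pi> v = 0"
    using A.part_sum_unique[OF x, of "\<pi> u" "\<pi> v"] hom(1)[of u v] hom(3) uv e by simp
  then show ?thesis using uv hom(1)[of u v] e by (intro bexI[of _ u]) simp_all
qed

text \<open>\<open>central_extension\<close> states centrality for the left argument. Skew symmetry
  turns it around for homogeneous elements, and the decomposition into parts gives the rest.\<close>

lemma central_right:
  assumes ce: "central_extension A E \<pi> Z"
  shows "brk E x Z = 0"
proof -
  interpret E: lie_superalgebra E using central_extensionD[OF ce] by simp
  have hom: "brk E y Z = 0" if "y \<in> part E p" for y p
    using E.skew[OF that central_extensionD(9)[OF ce]] central_extensionD(10)[OF ce] by simp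
  obtain y z where "y \<in> part E 0" "z \<in> part E 1" "x = y + z" using E.part_sum by blast
  then show ?thesis using hom E.linear_left[of Z] by (simp add: Vector_Spaces.linear_iff)
qed

lemma lin_ext_in_part:
  assumes E: "super_space E" and l: "\<And>i. l i \<in> part E (gen_parity i)" and x: "x \<in> part witt_alg p"
  shows "lin_ext (scl E) l x \<in> part E p"
proof -
  interpret E: super_space E by fact
  have "scl E (Poly_Mapping.lookup x i) (l i) \<in> part E p" if "i \<in> Poly_Mapping.keys x" for i
    using l[of i] x that E.subspace_scale[OF E.subspace_part] by (auto simp: in_part_witt_alg)
  then show ?thesis
    unfolding lin_ext_def by (intro E.subspace_sum[OF E.subspace_part])
qed

text \<open>The lifts extend to a linear even section, and \<open>b\<close> measures its failure to
  respect brackets. The lifts are a parameter because the lemma serves twice: for an arbitrary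
  homogeneous choice, and for a given Neveu-Schwarz basis, whose cocycle is then known
  explicitly.\<close>

lemma extension_from_lifts:
  fixes E :: "('e::ab_group_add) salgebra" and l :: "gen \<Rightarrow> 'e"
  defines "s \<equiv> lin_ext (scl E) l"
  assumes ce: "central_extension witt_alg E \<pi> Z"
    and l: "\<And>i. l i \<in> part E (gen_parity i)" "\<And>i. \<pi> (l i) = gvec i"
  obtains b where "two_cocycle witt_alg b"
    "lie_hom (extension_algebra witt_alg b) E (\<lambda>u. s (fst u) + scl E (snd u) Z)"
    "bij (\<lambda>u. s (fst u) + scl E (snd u) Z)" "\<And>x. \<pi> (s x) = x"
    "\<And>x y. brk E (s x) (s y) = s (witt_brk x y) + scl E (b x y) Z"
proof -
  interpret W: lie_superalgebra witt_alg by (rule lie_superalgebra_witt)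
  interpret E: lie_superalgebra E using central_extensionD[OF ce] by simp
  note hom = lie_homD[OF central_extensionD(5)[OF ce]] and ker = central_extensionD(7)[OF ce]
    and ZL = central_extensionD(10)[OF ce] and ZR = central_right[OF ce]
    and Z0 = central_extensionD(8)[OF ce] and Zp = central_extensionD(9)[OF ce]
  have s_lin: "Vector_Spaces.linear witt_scl (scl E) s"
    unfolding s_def by (rule linear_lin_ext[OF E.vector_space_axioms])
  then have s_add: "s (x + y) = s x + s y" and s_scl: "s (witt_scl c x) = scl E c (s x)" for x y c
    by (simp_all add: Vector_Spaces.linear_iff)
  have s_gvec: "s (gvec i) = l i" for i
    unfolding s_def by (rule lin_ext_gvec[OF E.vector_space_axioms])
  have brk_add: "brk E (x + x') y = brk E x y + brk E x' y" "brk E x (y + y') = brk E x y + brk E x y'"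
    and brk_scl: "brk E (scl E c x) y = scl E c (brk E x y)" "brk E x (scl E c y) = scl E c (brk E x y)"
    for x x' y y' c
    using E.linear_left[of y] E.linear_right[of x] by (simp_all add: Vector_Spaces.linear_iff)
  have \<pi>0: "\<pi> 0 = 0" using hom(1)[of 0 0] by simp
  have \<pi>Z: "\<pi> (scl E c Z) = 0" for c using ker by blast
  have \<pi>s: "\<pi> (s x) = x" for x
    by (rule witt_eq_on_gensI[OF vector_space_witt])
      (use l(2) hom in \<open>simp_all add: s_add s_scl s_gvec\<close>)
  have s_part: "s x \<in> part E p" if "x \<in> part witt_alg p" for x p
    unfolding s_def using lin_ext_in_part[OF E.super_space_axioms l(1) that] .
  have Zinj: "scl E c Z = scl E d Z \<longleftrightarrow> c = d" for c d
    using Z0 by (simp add: E.scale_right_imp_eq)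
  have "\<exists>c. brk E (s x) (s y) = s (witt_brk x y) + scl E c Z" for x y
  proof -
    have "\<pi> (brk E (s x) (s y) - s (witt_brk x y)) = 0"
      using hom(1)[of "brk E (s x) (s y) - s (witt_brk x y)" "s (witt_brk x y)"]
      by (simp add: hom(4) \<pi>s)
    then show ?thesis using ker by (metis diff_add_cancel add.commute)
  qed
  then obtain b where b: "brk E (s x) (s y) = s (witt_brk x y) + scl E (b x y) Z" for x y
    by metis
  \<comment> \<open>Since \<open>Z\<close> is nonzero, the value of \<open>b\<close> is unique; each
    property of \<open>b\<close> thus becomes an identity between brackets in
    \<open>E\<close>.\<close>
  have b_eqI: "b x y = c" if "brk E (s x) (s y) = s (witt_brk x y) + scl E c Z" for x y c
    using that b[of x y] Zinj by simp
  have bl: "bilinear_form witt_alg b"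
    unfolding bilinear_form_def Vector_Spaces.linear_iff
  proof (intro conjI allI W.vector_space_axioms vector_space_complex)
    fix x x' y :: witt and c
    show "b (x + x') y = b x y + b x' y" "b y (x + x') = b y x + b y x'"
      by (intro b_eqI; simp add: s_add brk_add b witt_brk_add_left witt_brk_add_right
          E.scale_left_distrib)+
    show "b (scl witt_alg c x) y = c * b x y" "b y (scl witt_alg c x) = c * b y x"
      by (intro b_eqI; simp add: s_scl brk_scl b witt_brk_scl_left witt_brk_scl_right
          E.scale_right_distrib)+
  qed
  have "two_cocycle witt_alg b"
    unfolding two_cocycle_iff[OF lie_superalgebra_witt]
  proof (intro conjI allI ballI impI bl)
    fix p q x y assume xy: "x \<in> part witt_alg p" "y \<in> part witt_alg q"
    show "b x y = 0" if pq: "p + q \<noteq> 0"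
    proof -
      have "s (witt_brk x y) \<in> part E (p + q)" "brk E (s x) (s y) \<in> part E (p + q)"
        using s_part[OF W.brk_part[OF xy]] E.brk_part[OF s_part s_part, OF xy]
        by (simp_all only: brk_witt_alg)
      \<comment> \<open>The multiple of \<open>Z\<close> is a difference of two elements of parity
        \<open>p + q\<close>, yet \<open>Z\<close> is even.\<close>
      then have "scl E (b x y) Z \<in> part E (p + q)"
        using b[of x y] E.subspace_diff[OF E.subspace_part] by (metis add_diff_cancel_left')
      moreover have "scl E (b x y) Z \<in> part E 0" using Zp E.subspace_scale[OF E.subspace_part] by blast
      ultimately have "scl E (b x y) Z = 0" using E.part_disjoint pq by blast
      then show ?thesis using Z0 by simp
    qed
    show "b x y = - ksign p q * b y x"
    proof (rule b_eqI)
      have "brk E (s x) (s y) = scl E (- ksign p q) (s (witt_brk y x) + scl E (b y x) Z)"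
        using E.skew[OF s_part[OF xy(1)] s_part[OF xy(2)]] by (simp add: b)
      also have "\<dots> = s (witt_scl (- ksign p q) (witt_brk y x)) + scl E (- ksign p q * b y x) Z"
        unfolding E.scale_right_distrib s_scl E.scale_scale ..
      also have "witt_scl (- ksign p q) (witt_brk y x) = witt_brk x y"
        using W.skew[OF xy] by simp
      finally show "brk E (s x) (s y) = s (witt_brk x y) + scl E (- ksign p q * b y x) Z" .
    qed
  next
    fix p q r x y z
    assume xyz: "x \<in> part witt_alg p" "y \<in> part witt_alg q" "z \<in> part witt_alg r"
    show "b x (brk witt_alg y z) = b (brk witt_alg x y) z + ksign p q * b y (brk witt_alg x z)"
    proof (rule b_eqI)
      \<comment> \<open>Inside a bracket a multiple of \<open>Z\<close> is invisible, so a lifted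
        bracket may be exchanged with the bracket of the lifts.\<close>
      have out: "brk E u (s v) = brk E u (s v + scl E c Z)" "brk E (s v) u = brk E (s v + scl E c Z) u"
        for u v c by (simp_all add: brk_add brk_scl ZL ZR)
      have "brk E (s x) (s (witt_brk y z)) = brk E (s x) (brk E (s y) (s z))"
        unfolding b[of y z] by (rule out)
      also have "\<dots> = brk E (brk E (s x) (s y)) (s z)
          + scl E (ksign p q) (brk E (s y) (brk E (s x) (s z)))"
        by (rule E.jacobi[OF s_part[OF xyz(1)] s_part[OF xyz(2)] s_part[OF xyz(3)]])
      also have "brk E (brk E (s x) (s y)) (s z) = s (witt_brk (witt_brk x y) z)
          + scl E (b (witt_brk x y) z) Z"
        unfolding b[of x y] out(2)[symmetric] by (rule b)
      also have "brk E (s y) (brk E (s x) (s z)) = s (witt_brk y (witt_brk x z))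
          + scl E (b y (witt_brk x z)) Z"
        unfolding b[of x z] out(1)[symmetric] by (rule b)
      also have "s (witt_brk (witt_brk x y) z) + scl E (b (witt_brk x y) z) Z
          + scl E (ksign p q) (s (witt_brk y (witt_brk x z)) + scl E (b y (witt_brk x z)) Z)
        = s (witt_brk (witt_brk x y) z + witt_scl (ksign p q) (witt_brk y (witt_brk x z)))
          + scl E (b (witt_brk x y) z + ksign p q * b y (witt_brk x z)) Z"
        by (simp add: s_add s_scl E.scale_right_distrib E.scale_left_distrib)
      also have "witt_brk (witt_brk x y) z + witt_scl (ksign p q) (witt_brk y (witt_brk x z))
          = witt_brk x (witt_brk y z)"
        using W.jacobi[OF xyz] by simp
      finally show "brk E (s x) (s (brk witt_alg y z)) = s (witt_brk x (brk witt_alg y z))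
        + scl E (b (brk witt_alg x y) z + ksign p q * b y (brk witt_alg x z)) Z"
        by simp
    qed
  qed
  moreover have "lie_hom (extension_algebra witt_alg b) E (\<lambda>u. s (fst u) + scl E (snd u) Z)"
  proof -
    interpret X: super_space "extension_algebra witt_alg b"
      using \<open>two_cocycle witt_alg b\<close> central_extensionD(4) by (auto simp: two_cocycle_def)
    have part: "s (fst u) + scl E (snd u) Z \<in> part E p"
      if "u \<in> part (extension_algebra witt_alg b) p" for u p
    proof -
      have "fst u \<in> part witt_alg p" "p = 0 \<or> snd u = 0"
        using that by (auto simp: extension_algebra_def split: if_splits)
      then show ?thesis
        using s_part Zp E.subspace_add[OF E.subspace_part] E.subspace_scale[OF E.subspace_part]
        by fastforce
    qed
    show ?thesis
      unfolding lie_hom_def Vector_Spaces.linear_iff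
    proof (intro conjI allI X.vector_space_axioms E.vector_space_axioms image_subsetI part)
    qed (simp_all add: extension_algebra_def brk_add brk_scl ZL ZR b s_add s_scl
        E.scale_left_distrib E.scale_right_distrib algebra_simps)
  qed
  moreover have "bij (\<lambda>u. s (fst u) + scl E (snd u) Z)"
  proof (intro bijI injI surjI)
    fix u v assume eq: "s (fst u) + scl E (snd u) Z = s (fst v) + scl E (snd v) Z"
    from arg_cong[OF this, of \<pi>] have "fst u = fst v" by (simp add: hom(1) \<pi>s \<pi>Z)
    with eq show "u = v" using Z0 by (simp add: prod_eq_iff)
  next
    have "\<exists>u. s (fst u) + scl E (snd u) Z = e" for e
    proof -
      have "\<pi> (e - s (\<pi> e)) = 0"
        using hom(1)[of "e - s (\<pi> e)" "s (\<pi> e)"] by (simp add: \<pi>s)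
      then obtain c where "e - s (\<pi> e) = scl E c Z" using ker by blast
      then show ?thesis by (intro exI[of _ "(\<pi> e, c)"]) (simp add: algebra_simps)
    qed
    then show "s (fst (SOME u. s (fst u) + scl E (snd u) Z = e))
        + scl E (snd (SOME u. s (fst u) + scl E (snd u) Z = e)) Z = e" for e
      by (rule someI_ex)
  qed
  ultimately show thesis using that b \<pi>s by blast
qed

section \<open>The Neveu-Schwarz algebra and uniqueness of the non-trivial extension\<close>

abbreviation ns_alg :: "(witt \<times> complex) salgebra" where
  "ns_alg \<equiv> extension_algebra witt_alg ns_cocycle"

lemma central_extension_ns_alg: "central_extension witt_alg ns_alg fst (0, 1)"
  using two_cocycle_ns_cocycle by (simp add: two_cocycle_def)

lemmas super_space_ns_alg = central_extensionD(4)[OF central_extension_ns_alg]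

text \<open>A section of the first projection has the form x, (x, f x). Compatibility with brackets
  says that \<open>b\<close> is the coboundary of \<open>f\<close>, and compatibility with parity
  says that \<open>f\<close> vanishes on odd generators.\<close>

lemma trivial_extension_cocycle_iff:
  assumes "two_cocycle witt_alg b"
  shows "trivial_extension witt_alg (extension_algebra witt_alg b) fst
    \<longleftrightarrow> (\<exists>f. Vector_Spaces.linear witt_scl (*) f \<and> (\<forall>n. f (gvec (Ggen n)) = 0)
          \<and> (\<forall>x y. b x y = f (witt_brk x y)))" (is "?L \<longleftrightarrow> ?R")
proof
  interpret X: super_space "extension_algebra witt_alg b"
    using assms central_extensionD(4) by (auto simp: two_cocycle_def)
  {
    assume ?L
    then obtain s where s: "lie_hom witt_alg (extension_algebra witt_alg b) s" "\<And>x. fst (s x) = x"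
      by (auto simp: trivial_extension_def)
    note hom = lie_homD[OF s(1)]
    define f where "f x = snd (s x)" for x
    have "Vector_Spaces.linear witt_scl (*) f"
      using hom(1,2) vector_space_witt vector_space_complex
      by (simp add: f_def Vector_Spaces.linear_iff extension_algebra_def)
    moreover have "f (gvec (Ggen n)) = 0" for n
      using hom(3)[of "gvec (Ggen n)" 1] by (auto simp: extension_algebra_def f_def mem_Times_iff)
    moreover have "b x y = f (witt_brk x y)" for x y
      using hom(4)[of x y] by (simp add: extension_algebra_def f_def s(2))
    ultimately show ?R by blast
  }
  {
    assume ?R
    then obtain f where f: "Vector_Spaces.linear witt_scl (*) f" "\<And>n. f (gvec (Ggen n)) = 0"
        "\<And>x y. b x y = f (witt_brk x y)"
      by blast
    note odd = even_form_odd_part[OF f(1,2)]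
    have "lie_hom witt_alg (extension_algebra witt_alg b) (\<lambda>x. (x, f x))"
      unfolding lie_hom_def Vector_Spaces.linear_iff
    proof (intro conjI allI image_subsetI X.vector_space_axioms)
      fix p x assume "x \<in> part witt_alg p"
      then show "(x, f x) \<in> part (extension_algebra witt_alg b) p"
        using odd by (cases p) (simp_all add: extension_algebra_def)
    qed (use f in \<open>simp_all add: extension_algebra_def Vector_Spaces.linear_iff\<close>)
    then show ?L unfolding trivial_extension_def by (intro exI[of _ "\<lambda>x. (x, f x)"]) simp
  }
qed

lemma ns_alg_nontrivial: "\<not> trivial_extension witt_alg ns_alg fst"
proof
  assume "trivial_extension witt_alg ns_alg fst"
  then have "two_coboundary witt_alg (\<lambda>x y. 1 * ns_cocycle x y)"
    unfolding trivial_extension_cocycle_iff[OF two_cocycle_ns_cocycle] two_coboundary_def by auto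
  from ns_cocycle_not_coboundary[OF this] show False by simp
qed

lemma trivial_extension_transfer:
  assumes "equivalent_extensions E \<pi> C F \<rho> D" "trivial_extension A E \<pi>"
  shows "trivial_extension A F \<rho>"
proof -
  obtain f where f: "lie_hom E F f" "\<And>x. \<rho> (f x) = \<pi> x"
    using assms(1) by (auto simp: equivalent_extensions_def)
  obtain s where s: "lie_hom A E s" "\<And>x. \<pi> (s x) = x"
    using assms(2) by (auto simp: trivial_extension_def)
  show ?thesis
    unfolding trivial_extension_def
    using lie_hom_comp[OF s(1) f(1)] s(2) f(2) by (intro exI[of _ "f \<circ> s"]) simp
qed

lemma extension_as_cocycle:
  fixes E :: "('e::ab_group_add) salgebra"
  assumes ce: "central_extension witt_alg E \<pi> Z"
  obtains b where "two_cocycle witt_alg b"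
    "equivalent_extensions (extension_algebra witt_alg b) fst (0, 1) E \<pi> Z"
proof -
  have "\<exists>e\<in>part E (gen_parity i). \<pi> e = gvec i" for i
    using homogeneous_lift[OF ce, of "gvec i" "gen_parity i"] by simp
  then obtain l where l: "\<And>i. l i \<in> part E (gen_parity i)" "\<And>i. \<pi> (l i) = gvec i" by metis
  interpret E: super_space E using central_extensionD[OF ce] by simp
  let ?s = "lin_ext (scl E) l"
  obtain b where b: "two_cocycle witt_alg b"
      "lie_hom (extension_algebra witt_alg b) E (\<lambda>u. ?s (fst u) + scl E (snd u) Z)"
      "bij (\<lambda>u. ?s (fst u) + scl E (snd u) Z)" "\<And>x. \<pi> (?s x) = x"
    by (rule extension_from_lifts[OF ce l]) blast
  have "\<pi> (scl E c Z) = 0" for c using central_extensionD(7)[OF ce] by blast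
  moreover have "?s 0 = 0" by (simp add: lin_ext_def)
  ultimately have "equivalent_extensions (extension_algebra witt_alg b) fst (0, 1) E \<pi> Z"
    unfolding equivalent_extensions_def
    using b lie_homD(1)[OF central_extensionD(5)[OF ce]]
    by (intro exI[of _ "\<lambda>u. ?s (fst u) + scl E (snd u) Z"]) simp
  with b(1) show thesis by (rule that)
qed

text \<open>The cocycle of the extension is k times \<open>ns_cocycle\<close> plus the coboundary of
  \<open>f\<close>. For k = 0 the extension would split; otherwise a linear change of the central
  coordinate absorbs \<open>f\<close> and the scalar. It carries \<open>(0, 1)\<close> to
  \<open>(0, k)\<close>, which is why the central element gets rescaled.\<close>

lemma nontrivial_extension_ns:
  fixes E :: "('e::ab_group_add) salgebra"
  assumes ce: "central_extension witt_alg E \<pi> Z" and nt: "\<not> trivial_extension witt_alg E \<pi>"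
  obtains k where "k \<noteq> 0" "equivalent_extensions ns_alg fst (0, 1) E \<pi> (scl E k Z)"
proof -
  obtain b where b: "two_cocycle witt_alg b"
      "equivalent_extensions (extension_algebra witt_alg b) fst (0, 1) E \<pi> Z"
    by (rule extension_as_cocycle[OF ce])
  let ?X = "extension_algebra witt_alg b"
  obtain k f where f: "Vector_Spaces.linear witt_scl (*) f" "\<And>n. f (gvec (Ggen n)) = 0"
      and bk: "b = (\<lambda>x y. k * ns_cocycle x y + f (witt_brk x y))"
    by (rule cocycle_classification[OF b(1)]) blast
  have X: "super_space ?X" using b(1) central_extensionD(4) by (auto simp: two_cocycle_def)
  have "\<not> trivial_extension witt_alg ?X fst"
    using trivial_extension_transfer[OF b(2)] nt by blast
  then have k: "k \<noteq> 0"
    unfolding trivial_extension_cocycle_iff[OF b(1)] using f bk by auto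
  note odd = even_form_odd_part[OF f(1,2)]
  interpret X: super_space ?X by (rule X)
  interpret N: super_space ns_alg by (rule super_space_ns_alg)
  interpret f: Vector_Spaces.linear witt_scl "(*)" f by (rule f(1))
  let ?g = "\<lambda>u. (fst u, f (fst u) + k * snd u)"
  have "lie_hom ns_alg ?X ?g"
    unfolding lie_hom_def Vector_Spaces.linear_iff
  proof (intro conjI allI image_subsetI X.vector_space_axioms N.vector_space_axioms)
    fix p x assume "x \<in> part ns_alg p"
    then show "?g x \<in> part ?X p"
      using odd by (cases p) (auto simp: extension_algebra_def)
  next
    fix u v :: "witt \<times> complex" and c
    have b_eq: "b (fst u) (fst v) = k * ns_cocycle (fst u) (fst v) + f (witt_brk (fst u) (fst v))"
      by (simp only: bk)
    show "?g (u + v) = ?g u + ?g v" by (simp add: f.add distrib_left)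
    show "?g (scl ns_alg c u) = scl ?X c (?g u)"
      by (simp add: extension_algebra_def f.scale distrib_left)
    show "?g (brk ns_alg u v) = brk ?X (?g u) (?g v)"
      by (simp add: extension_algebra_def b_eq)
  qed
  moreover have "bij ?g"
  proof (rule o_bij)
    show "(\<lambda>u. (fst u, (snd u - f (fst u)) / k)) \<circ> ?g = id" using k by (auto simp: fun_eq_iff)
    show "?g \<circ> (\<lambda>u. (fst u, (snd u - f (fst u)) / k)) = id" using k by (auto simp: fun_eq_iff)
  qed
  ultimately have "equivalent_extensions ns_alg fst (0, 1) ?X fst (0, k)"
    unfolding equivalent_extensions_def by (intro exI[of _ ?g]) (simp add: f.zero)
  moreover have "equivalent_extensions ?X fst (0, k) E \<pi> (scl E k Z)"
    using equivalent_extensions_rescale[OF b(2), of k] by (simp add: extension_algebra_def)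
  ultimately show thesis using that k equivalent_extensions_trans by blast
qed

lemma nontrivial_extensions_equivalent:
  fixes E :: "('e::ab_group_add) salgebra" and F :: "('f::ab_group_add) salgebra"
  assumes E: "central_extension witt_alg E \<pi> Z" "\<not> trivial_extension witt_alg E \<pi>"
    and F: "central_extension witt_alg F \<rho> Z'" "\<not> trivial_extension witt_alg F \<rho>"
  shows "\<exists>k. k \<noteq> 0 \<and> equivalent_extensions E \<pi> Z F \<rho> (scl F k Z')"
proof -
  interpret E: super_space E using central_extensionD[OF E(1)] by simp
  interpret F: super_space F using central_extensionD[OF F(1)] by simp
  obtain k where k: "k \<noteq> 0" "equivalent_extensions ns_alg fst (0, 1) E \<pi> (scl E k Z)"
    by (rule nontrivial_extension_ns[OF E])
  obtain l where l: "l \<noteq> 0" "equivalent_extensions ns_alg fst (0, 1) F \<rho> (scl F l Z')"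
    by (rule nontrivial_extension_ns[OF F])
  have "equivalent_extensions E \<pi> (scl E k Z) F \<rho> (scl F l Z')"
    using equivalent_extensions_trans[OF equivalent_extensions_sym[OF super_space_ns_alg
        E.super_space_axioms k(2)] l(2)] .
  \<comment> \<open>Both central elements arrive with a factor; dividing by \<open>k\<close> moves
    the whole factor to the second extension.\<close>
  from equivalent_extensions_rescale[OF this, of "1 / k"]
  have "equivalent_extensions E \<pi> Z F \<rho> (scl F (l / k) Z')"
    using k(1) by simp
  then show ?thesis using k l by (intro exI[of _ "l / k"]) simp
qed

text \<open>The class of \<open>ns_cocycle\<close> spans by \<open>cocycle_classification\<close>,
  and it is nonzero because no coboundary is cubic in the weight.\<close>

lemma dim_witt_H2: "vector_space.dim witt_H2_scl (UNIV :: witt_H2 set) = 1"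
proof -
  interpret vector_space witt_H2_scl by (rule vector_space_witt_H2)
  \<comment> \<open>\<open>cohomologous\<close> is a partial relation; its reflexivity at
    \<open>ns_cocycle\<close> is the cocycle property that permits passing to the class.\<close>
  have ns_refl: "cohomologous ns_cocycle ns_cocycle"
    using two_cocycle_ns_cocycle two_coboundary_zero[OF lie_superalgebra_witt]
    by (simp add: cohomologous_def)
  define w where "w = abs_witt_H2 ns_cocycle"
  have scl_w: "witt_H2_scl k w = abs_witt_H2 (\<lambda>x y. k * ns_cocycle x y)" for k
    unfolding w_def by (rule witt_H2_scl.abs_eq[OF ns_refl])
  have "w \<noteq> 0"
  proof
    assume "w = 0"
    moreover have "cohomologous (\<lambda>_ _. 0) (\<lambda>_ _. 0)"
      using two_cocycle_zero[OF lie_superalgebra_witt] two_coboundary_zero[OF lie_superalgebra_witt]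
      by (simp add: cohomologous_def)
    ultimately have "cohomologous ns_cocycle (\<lambda>_ _. 0)"
      using ns_refl Quotient3_rel[OF Quotient3_witt_H2, of ns_cocycle "\<lambda>_ _. 0"]
      by (simp add: w_def zero_witt_H2.abs_eq)
    then have "two_coboundary witt_alg (\<lambda>x y. 1 * ns_cocycle x y)" by (simp add: cohomologous_def)
    from ns_cocycle_not_coboundary[OF this] show False by simp
  qed
  have "\<exists>k. u = witt_H2_scl k w" for u
  proof -
    obtain b where b: "cohomologous b b" "u = abs_witt_H2 b"
      using Quotient3_abs_rep[OF Quotient3_witt_H2] Quotient3_rep_reflp[OF Quotient3_witt_H2]
      by metis
    then have "two_cocycle witt_alg b" by (simp add: cohomologous_def)
    then obtain k f where f: "Vector_Spaces.linear witt_scl (*) f"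
        and bk: "b = (\<lambda>x y. k * ns_cocycle x y + f (witt_brk x y))"
      by (rule cocycle_classification) blast
    have "two_coboundary witt_alg (\<lambda>x y. b x y - k * ns_cocycle x y)"
      using f by (auto simp: two_coboundary_def bk)
    then have "cohomologous b (\<lambda>x y. k * ns_cocycle x y)"
      using b(1) two_cocycle_scale[OF lie_superalgebra_witt two_cocycle_ns_cocycle]
      by (simp add: cohomologous_def)
    then show ?thesis
      unfolding b(2) scl_w using Quotient3_rel_abs[OF Quotient3_witt_H2] by blast
  qed
  then have "UNIV \<subseteq> span {w}"
    by (auto simp: span_singleton)
  then show ?thesis
    using dim_unique[of "{w}" UNIV 1] \<open>w \<noteq> 0\<close> by simp
qed

section \<open>Bases with the Neveu--Schwarz relations\<close>

text \<open>Conjugating the second coordinate keeps the central element \<open>(0, 1)\<close>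
  selfadjoint while the map stays conjugate-linear.\<close>

definition ns_star :: "witt \<times> complex \<Rightarrow> witt \<times> complex" where
  "ns_star u = (witt_star (fst u), cnj (snd u))"

text \<open>The star exchanges the two generators of a pair of total weight 0, so starring and
  swapping fixes the pair. What remains is that the values there are real.\<close>

lemma ns_gen_star: "cnj (ns_gen (gen_star j) (gen_star i)) = ns_gen i j"
proof (cases i; cases j)
  fix m n assume ij: "i = Dgen m" "j = Dgen n"
  show ?thesis
  proof (cases "n = - m")
    case True
    show ?thesis unfolding ij True by simp
  qed (auto simp: ij)
next
  fix k l assume ij: "i = Ggen k" "j = Ggen l"
  show ?thesis
  proof (cases "l = - k - 1")
    case True
    show ?thesis unfolding ij True by (simp add: half_def)
  qed (auto simp: ij)
qed simp_all

lemma ns_cocycle_star: "ns_cocycle (witt_star y) (witt_star x) = cnj (ns_cocycle x y)"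
proof -
  note bl = bilinear_formD[OF bilinear_form_ns_cocycle]
  have "ns_cocycle = (\<lambda>x y. cnj (ns_cocycle (witt_star y) (witt_star x)))"
  proof (rule bilinear_form_eq_on_gens[OF bilinear_form_ns_cocycle])
    show "bilinear_form witt_alg (\<lambda>x y. cnj (ns_cocycle (witt_star y) (witt_star x)))"
      by (simp add: bilinear_form_def Vector_Spaces.linear_iff vector_space_witt
          vector_space_complex witt_star_add witt_star_scl bl)
  qed (simp add: ns_gen_star)
  then show ?thesis by (metis complex_cnj_cnj)
qed

lemma star_structure_ns_star: "star_structure ns_alg ns_star"
  unfolding star_structure_def
proof (intro conjI allI)
  have W: "witt_star ` part witt_alg p \<subseteq> part witt_alg p"
    "witt_star (witt_brk x y) = witt_brk (witt_star y) (witt_star x)" for p x y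
    using star_structure_witt by (auto simp: star_structure_def)
  fix x y :: "witt \<times> complex" and c p
  show "ns_star (x + y) = ns_star x + ns_star y" by (simp add: ns_star_def witt_star_add)
  show "ns_star (scl ns_alg c x) = scl ns_alg (cnj c) (ns_star x)"
    by (simp add: ns_star_def extension_algebra_def witt_star_scl)
  show "ns_star (ns_star x) = x" by (simp add: ns_star_def witt_star_invol)
  show "ns_star ` part ns_alg p \<subseteq> part ns_alg p"
    using W(1)[of p] by (auto simp: ns_star_def extension_algebra_def)
  show "ns_star (brk ns_alg x y) = brk ns_alg (ns_star y) (ns_star x)"
    by (simp add: ns_star_def extension_algebra_def W(2) ns_cocycle_star)
qed

lemma star_structure_transport:
  assumes f: "lie_hom A B f" "bij f" and A: "super_space A" and B: "super_space B"
    and st: "star_structure A st"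
  shows "star_structure B (\<lambda>x. f (st (inv f x)))"
proof -
  note hom = lie_homD[OF f(1)] and inv = lie_homD[OF lie_hom_inv[OF f A B]]
  have fi: "f (inv f x) = x" "inv f (f y) = y" for x y
    using f(2) by (simp_all add: bij_is_surj surj_f_inv_f bij_is_inj)
  have "f (st (inv f x)) \<in> part B p" if "x \<in> part B p" for x p
    using st hom(3) inv(3)[OF that] by (auto simp: star_structure_def image_subset_iff)
  then show ?thesis
    using st by (auto simp: star_structure_def image_subset_iff hom(1,2,4) inv(1,2,4) fi)
qed

definition ns_base :: "(witt \<times> complex) set" where
  "ns_base = insert (0, 1) (range (\<lambda>i. (gvec i, 0)))"

text \<open>Each member of the family has a coordinate functional that is 1 on it and 0 on all other
  members, and therefore 0 on their span.\<close>

lemma independent_ns_base: "\<not> module.dependent (scl ns_alg) ns_base"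
proof -
  interpret super_space ns_alg by (rule super_space_ns_alg)
  have lin: "Vector_Spaces.linear (scl ns_alg) (*) (\<lambda>u. Poly_Mapping.lookup (fst u) i)"
    "Vector_Spaces.linear (scl ns_alg) (*) snd" for i
    using vector_space_axioms vector_space_complex
    by (simp_all add: Vector_Spaces.linear_iff extension_algebra_def lookup_add)
  have zero: "h u = 0" if "Vector_Spaces.linear (scl ns_alg) (*) h" "u \<in> span S" "\<forall>v\<in>S. h v = 0"
    for h :: "witt \<times> complex \<Rightarrow> complex" and u S
  proof -
    interpret h: Vector_Spaces.linear "scl ns_alg" "(*)" h by fact
    show ?thesis using that(2)
      by (induction rule: span_induct_alt) (use that(3) in \<open>simp_all add: h.zero h.add h.scale\<close>)
  qed
  show ?thesis
    unfolding dependent_def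
  proof
    assume "\<exists>a\<in>ns_base. a \<in> span (ns_base - {a})"
    then obtain a where a: "a \<in> ns_base" "a \<in> span (ns_base - {a})" by blast
    from a(1) consider "a = (0, 1)" | i where "a = (gvec i, 0)" by (auto simp: ns_base_def)
    then show False
    proof cases
      case 1
      then have "snd a = 0" by (intro zero[OF lin(2) a(2)]) (auto simp: ns_base_def)
      then show False using 1 by simp
    next
      case 2
      then have "Poly_Mapping.lookup (fst a) i = 0"
        by (intro zero[OF lin(1) a(2)]) (auto simp: ns_base_def lookup_single when_def split: if_splits)
      then show False using 2 by simp
    qed
  qed
qed

lemma witt_scl_zero_right [simp]: "witt_scl c 0 = 0"
  by (rule poly_mapping_eqI) simp

lemma span_ns_base: "module.span (scl ns_alg) ns_base = UNIV"
proof -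
  interpret super_space ns_alg by (rule super_space_ns_alg)
  have "u \<in> span ns_base" for u
  proof -
    have sum_pair: "(\<Sum>i\<in>S. (h i, 0)) = (sum h S, 0 :: complex)" if "finite S"
      for h :: "gen \<Rightarrow> witt" and S
      using that by (induction S rule: finite_induct) (simp_all add: zero_prod_def)
    have "(fst u, 0) = (\<Sum>i\<in>Poly_Mapping.keys (fst u).
        scl ns_alg (Poly_Mapping.lookup (fst u) i) (gvec i, 0))"
      using witt_expansion[of "fst u"]
      by (simp add: extension_algebra_def sum_pair del: witt_scl_single)
    moreover have "\<dots> \<in> span ns_base"
      by (intro span_sum span_scale span_base) (auto simp: ns_base_def)
    moreover have "scl ns_alg (snd u) (0, 1) \<in> span ns_base"
      by (intro span_scale span_base) (auto simp: ns_base_def)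
    ultimately have "(fst u, 0) + scl ns_alg (snd u) (0, 1) \<in> span ns_base"
      using span_add by simp
    then show ?thesis by (simp add: extension_algebra_def)
  qed
  then show ?thesis by blast
qed

lemma central_extension_rescale:
  assumes ce: "central_extension A E \<pi> Z" and k: "k \<noteq> 0"
  shows "central_extension A E \<pi> (scl E k Z)"
proof -
  interpret E: lie_superalgebra E using central_extensionD[OF ce] by simp
  have "range (\<lambda>c. scl E c Z) = range (\<lambda>c. scl E c (scl E k Z))"
  proof (intro equalityI subsetI)
    fix x assume "x \<in> range (\<lambda>c. scl E c Z)"
    then obtain c where "x = scl E c Z" by blast
    then have "x = scl E (c / k) (scl E k Z)" using k by simp
    then show "x \<in> range (\<lambda>c. scl E c (scl E k Z))" by blast
  qed auto
  moreover have "scl E k Z \<noteq> 0" "scl E k Z \<in> part E 0"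
    using central_extensionD[OF ce] k E.subspace_scale[OF E.subspace_part] by auto
  moreover have "brk E (scl E k Z) x = 0" for x
    using E.linear_left[of x] central_extensionD(10)[OF ce] by (simp add: Vector_Spaces.linear_iff)
  ultimately show ?thesis using ce by (simp add: central_extension_def)
qed

text \<open>The basis, the star and the relations are transported from \<open>ns_alg\<close> along
  an isomorphism. The given \<open>Z\<close> may be wrongly normalised, so \<open>C\<close> is a
  nonzero multiple of it.\<close>

lemma neveu_schwarz_basis_exists:
  fixes E :: "('e::ab_group_add) salgebra"
  assumes ce: "central_extension witt_alg E \<pi> Z" and nt: "\<not> trivial_extension witt_alg E \<pi>"
  shows "\<exists>st L G C. neveu_schwarz_basis E \<pi> st L G C"
proof -
  obtain k where k: "k \<noteq> 0" "equivalent_extensions ns_alg fst (0, 1) E \<pi> (scl E k Z)"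
    by (rule nontrivial_extension_ns[OF ce nt])
  define C where "C = scl E k Z"
  have ceC: "central_extension witt_alg E \<pi> C"
    unfolding C_def by (rule central_extension_rescale[OF ce k(1)])
  obtain f where f: "lie_hom ns_alg E f" "bij f" "\<And>u. \<pi> (f u) = fst u" "f (0, 1) = C"
    using k(2) by (auto simp: equivalent_extensions_def C_def)
  note hom = lie_homD[OF f(1)]
  interpret E: super_space E using central_extensionD[OF ce] by simp
  interpret f: Vector_Spaces.linear "scl ns_alg" "scl E" f by (rule hom(5))
  define l where "l i = f (gvec i, 0)" for i
  have inv_f: "inv f (f u) = u" for u using f(2) by (simp add: bij_is_inj)
  have f_inv: "f (inv f x) = x" for x using f(2) by (simp add: bij_is_surj surj_f_inv_f)
  have l_part: "l i \<in> part E (gen_parity i)" for i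
    unfolding l_def by (rule hom(3)) (simp add: extension_algebra_def)
  have "range l \<union> {C} = f ` ns_base"
    by (auto simp: ns_base_def l_def f(4))
  moreover have "range l = range (\<lambda>n. l (Dgen n)) \<union> range (\<lambda>n. l (Ggen n))"
  proof -
    have "l i \<in> range (\<lambda>n. l (Dgen n)) \<union> range (\<lambda>n. l (Ggen n))" for i by (cases i) auto
    then show ?thesis by auto
  qed
  ultimately have base: "range (\<lambda>n. l (Dgen n)) \<union> range (\<lambda>n. l (Ggen n)) \<union> {C} = f ` ns_base" by simp
  have single: "f (Poly_Mapping.single i c, t) = scl E c (l i) + scl E t C" for i c t
    unfolding l_def f(4)[symmetric] f.scale[symmetric] f.add[symmetric]
    by (simp add: extension_algebra_def)
  have brk_l: "brk E (l i) (l j) = f (gen_brk i j, ns_gen i j)" for i j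
    unfolding l_def hom(4)[symmetric] by (simp add: extension_algebra_def)
  have star_l: "f (ns_star (inv f (l i))) = l (gen_star i)" for i
    by (simp add: l_def inv_f ns_star_def)
  have "neveu_schwarz_basis E \<pi> (\<lambda>x. f (ns_star (inv f x))) (\<lambda>n. l (Dgen n)) (\<lambda>n. l (Ggen n)) C"
    unfolding neveu_schwarz_basis_def base
  proof (intro conjI allI ceC)
    show "star_structure E (\<lambda>x. f (ns_star (inv f x)))"
      by (rule star_structure_transport[OF f(1,2) super_space_ns_alg E.super_space_axioms
            star_structure_ns_star])
    show "\<pi> (f (ns_star (inv f x))) = witt_star (\<pi> x)" for x
      using f(3)[of "inv f x"] by (simp add: f(3) ns_star_def f_inv)
    show "\<not> E.dependent (f ` ns_base)"
      using f.independent_injective_image[OF independent_ns_base] f(2)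
      by (metis bij_is_inj inj_on_subset subset_UNIV)
    show "E.span (f ` ns_base) = UNIV"
      unfolding f.span_image span_ns_base using f(2) by (simp add: bij_is_surj)
    show "l (Dgen n) \<in> part E 0" "l (Ggen n) \<in> part E 1" for n
      using l_part[of "Dgen n"] l_part[of "Ggen n"] by simp_all
    show "\<pi> (l (Dgen n)) = wittd n" "\<pi> (l (Ggen n)) = wittg n" for n
      by (simp_all add: l_def f(3) wittd_def wittg_def)
    show "f (ns_star (inv f (l (Dgen n)))) = l (Dgen (- n))"
      "f (ns_star (inv f (l (Ggen n)))) = l (Ggen (- n - 1))" for n
      by (simp_all add: star_l)
  qed (simp_all add: brk_l single)
  then show ?thesis by blast
qed

text \<open>With \<open>L\<close> and \<open>G\<close> as lifts of the generators, the relations say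
  that the resulting cocycle is exactly \<open>ns_cocycle\<close>. The given \<open>C\<close> thus
  corresponds to \<open>(0, 1)\<close> without rescaling, which makes the lifting of projective
  representations available for every such basis.\<close>

lemma neveu_schwarz_basis_equivalent:
  fixes E :: "('e::ab_group_add) salgebra"
  assumes basis: "neveu_schwarz_basis E \<pi> st L G C"
  shows "equivalent_extensions ns_alg fst (0, 1) E \<pi> C"
proof -
  have ce: "central_extension witt_alg E \<pi> C" using basis by (simp add: neveu_schwarz_basis_def)
  interpret E: super_space E using central_extensionD[OF ce] by simp
  define l where "l i = (case i of Dgen n \<Rightarrow> L n | Ggen n \<Rightarrow> G n)" for i
  have l: "l i \<in> part E (gen_parity i)" "\<pi> (l i) = gvec i" for i
    using basis by (cases i; simp add: l_def neveu_schwarz_basis_def wittd_def wittg_def)+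
  let ?s = "lin_ext (scl E) l"
  obtain b where b: "two_cocycle witt_alg b"
      "lie_hom (extension_algebra witt_alg b) E (\<lambda>u. ?s (fst u) + scl E (snd u) C)"
      "bij (\<lambda>u. ?s (fst u) + scl E (snd u) C)" "\<And>x. \<pi> (?s x) = x"
      "\<And>x y. brk E (?s x) (?s y) = ?s (witt_brk x y) + scl E (b x y) C"
    by (rule extension_from_lifts[OF ce l]) blast
  have s_single: "?s (Poly_Mapping.single i c) = scl E c (l i)" for i c
    by (rule lin_ext_single[OF E.vector_space_axioms])
  have brk_l: "brk E (l i) (l j) = ?s (gen_brk i j) + scl E (b (gvec i) (gvec j)) C" for i j
    using b(5)[of "gvec i" "gvec j"] by (simp add: s_single)
  have Cinj: "c = d" if "scl E c C = scl E d C" for c d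
    using that central_extensionD(8)[OF ce] by simp
  have LL: "brk E (L m) (L n) = scl E (of_int m - of_int n) (L (m + n))
      + scl E (ns_gen (Dgen m) (Dgen n)) C" for m n
    using basis by (simp only: neveu_schwarz_basis_def ns_gen.simps)
  have GG: "brk E (G k) (G l) = scl E 2 (L (k + l + 1))
      + scl E (ns_gen (Ggen k) (Ggen l)) C" for k l
    using basis by (simp only: neveu_schwarz_basis_def ns_gen.simps)
  have "b = ns_cocycle"
  proof (rule bilinear_form_eq_on_gens[OF two_cocycleD(1)[OF b(1)] bilinear_form_ns_cocycle])
    fix i j
    show "b (gvec i) (gvec j) = ns_cocycle (gvec i) (gvec j)"
    proof (cases "gen_parity i + gen_parity j = 0")
      case False
      then have "ns_gen i j = 0" by (cases i; cases j) auto
      then show ?thesis using two_cocycleD(2)[OF b(1) False] by simp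
    next
      case True
      have "scl E (b (gvec i) (gvec j)) C = scl E (ns_gen i j) C"
      proof (cases i)
        case (Dgen m)
        with True obtain n where "j = Dgen n" by (cases j) auto
        with Dgen show ?thesis
          using brk_l[of i j] LL[of m n] by (auto simp: l_def s_single simp del: ns_gen.simps)
      next
        case (Ggen m)
        with True obtain n where "j = Ggen n" by (cases j) auto
        with Ggen show ?thesis
          using brk_l[of i j] GG[of m n] by (auto simp: l_def s_single simp del: ns_gen.simps)
      qed
      from Cinj[OF this] show ?thesis by simp
    qed
  qed
  moreover have "\<pi> (scl E c C) = 0" for c using central_extensionD(7)[OF ce] by blast
  moreover have "?s 0 = 0" by (simp add: lin_ext_def)
  ultimately show ?thesis
    unfolding equivalent_extensions_def
    using b lie_homD(1)[OF central_extensionD(5)[OF ce]]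
    by (intro exI[of _ "\<lambda>u. ?s (fst u) + scl E (snd u) C"]) simp
qed

section \<open>Projective representations\<close>

lemma projective_representationD:
  assumes "projective_representation A V P \<beta>"
  shows "super_space V" "P (x + y) v = P x v + P y v" "P (scl A c x) v = scl V c (P x v)"
    "P x (v + w) = P x v + P x w" "P x (scl V c v) = scl V c (P x v)"
    "x \<in> part A p \<Longrightarrow> v \<in> part V q \<Longrightarrow> P x v \<in> part V (p + q)"
    "x \<in> part A p \<Longrightarrow> y \<in> part A q \<Longrightarrow>
      P x (P y v) - scl V (ksign p q) (P y (P x v)) = P (brk A x y) v + scl V (\<beta> x y) v"
proof -
  note A = assms[unfolded projective_representation_def Vector_Spaces.linear_iff]
  show "super_space V" "P (x + y) v = P x v + P y v" "P (scl A c x) v = scl V c (P x v)"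
    "P x (v + w) = P x v + P x w" "P x (scl V c v) = scl V c (P x v)"
    using A by simp_all
  show "x \<in> part A p \<Longrightarrow> v \<in> part V q \<Longrightarrow> P x v \<in> part V (p + q)" using A by blast
  show "x \<in> part A p \<Longrightarrow> y \<in> part A q \<Longrightarrow>
      P x (P y v) - scl V (ksign p q) (P y (P x v)) = P (brk A x y) v + scl V (\<beta> x y) v"
    using A by blast
qed

lemma representation_pullback:
  assumes h: "lie_hom E F h" and R: "representation F V R"
  shows "representation E V (\<lambda>x. R (h x))"
proof -
  note hom = lie_homD[OF h]
  note RR = projective_representationD[OF R[unfolded representation_def]]
  have "vector_space (scl E)" using hom(5) by (simp add: Vector_Spaces.linear_iff)
  moreover have "vector_space (scl V)" using RR(1) by (simp add: super_space_def)
  ultimately show ?thesis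
    unfolding representation_def projective_representation_def Vector_Spaces.linear_iff
    using RR(1-6) RR(7)[OF hom(3) hom(3)] hom by simp
qed

lemma (in super_space) homogeneous_nonzero:
  assumes "(UNIV :: 'a set) \<noteq> {0}"
  obtains v p where "v \<in> part V p" "v \<noteq> 0"
proof -
  obtain x :: 'a where "x \<noteq> 0" using assms by auto
  moreover obtain y z where "y \<in> part V 0" "z \<in> part V 1" "x = y + z" using part_sum by blast
  ultimately show thesis using that[of y 0] that[of z 1] by fastforce
qed

text \<open>\<open>\<beta>\<close> is constrained on homogeneous pairs only, so it is replaced by
  the bilinear extension of its values on generators. The cocycle identities for the replacement are
  read off from scalars acting on a nonzero vector.\<close>

lemma projective_cocycle:
  fixes V :: "('v::ab_group_add) sspace"
  assumes P: "projective_representation witt_alg V P \<beta>" and nz: "(UNIV :: 'v set) \<noteq> {0}"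
  obtains b where "two_cocycle witt_alg b" "projective_representation witt_alg V P b"
proof -
  note PD = projective_representationD[OF P, unfolded scl_witt_alg brk_witt_alg]
  interpret V: super_space V by (rule PD(1))
  define b where "b = bilin_ext (\<lambda>i j. \<beta> (gvec i) (gvec j))"
  have bl: "bilinear_form witt_alg b" unfolding b_def by (rule bilinear_form_bilin_ext)
  note lin = PD(2-5) bilinear_formD[OF bl] witt_brk_add_left witt_brk_add_right witt_brk_scl_left
    witt_brk_scl_right V.scale_right_distrib V.scale_left_distrib V.scale_right_diff_distrib
  have D: "P x (P y v) - scl V (ksign p q) (P y (P x v)) - P (witt_brk x y) v = scl V (b x y) v"
    if x: "x \<in> part witt_alg p" and y: "y \<in> part witt_alg q" for x y p q v
  proof (rule witt_eq_on_gensI[OF V.vector_space_axioms, of "\<lambda>x. P x (P y v)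
        - scl V (ksign p q) (P y (P x v)) - P (witt_brk x y) v" "\<lambda>x. scl V (b x y) v"])
    fix i assume "i \<in> Poly_Mapping.keys x"
    with x have i: "gen_parity i = p" by (auto simp: in_part_witt_alg)
    show "P (gvec i) (P y v) - scl V (ksign p q) (P y (P (gvec i) v)) - P (witt_brk (gvec i) y) v
      = scl V (b (gvec i) y) v"
    proof (rule witt_eq_on_gensI[OF V.vector_space_axioms, of "\<lambda>y. P (gvec i) (P y v)
        - scl V (ksign p q) (P y (P (gvec i) v)) - P (witt_brk (gvec i) y) v"])
      fix j assume "j \<in> Poly_Mapping.keys y"
      with y have j: "gen_parity j = q" by (auto simp: in_part_witt_alg)
      show "P (gvec i) (P (gvec j) v) - scl V (ksign p q) (P (gvec j) (P (gvec i) v))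
          - P (witt_brk (gvec i) (gvec j)) v = scl V (b (gvec i) (gvec j)) v"
        using PD(7)[of "gvec i" p "gvec j" q v] i j by (simp add: b_def)
    qed (simp_all add: lin mult.commute)
  qed (simp_all add: lin mult.commute)
  have brk_eq: "P (witt_brk x y) v
      = P x (P y v) - scl V (ksign p q) (P y (P x v)) - scl V (b x y) v"
    if "x \<in> part witt_alg p" "y \<in> part witt_alg q" for x y p q v
    using D[OF that, of v] by (simp add: algebra_simps)
  \<comment> \<open>Choosing the test vector homogeneous allows parity to be compared in
    \<open>par\<close>.\<close>
  obtain v r where v: "v \<in> part V r" "v \<noteq> 0" by (rule V.homogeneous_nonzero[OF nz])
  have scl_inj: "c = d" if "scl V c v = scl V d v" for c d using that v(2) by simp
  \<comment> \<open>For opposite parities the three operators in the defining relation all change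
    the parity of \<open>v\<close>, while the scalar preserves it.\<close>
  have par: "b x y = 0" if x: "x \<in> part witt_alg p" and y: "y \<in> part witt_alg q" and pq: "p \<noteq> q"
    for x y p q
  proof -
    interpret W: lie_superalgebra witt_alg by (rule lie_superalgebra_witt)
    have "P x (P y v) \<in> part V (p + (q + r))" "P y (P x v) \<in> part V (q + (p + r))"
      "P (witt_brk x y) v \<in> part V (p + q + r)"
      using PD(6) x y v(1) W.brk_part[OF x y] by (simp_all only: brk_witt_alg)
    then have "scl V (b x y) v \<in> part V (r + 1)"
      unfolding D[OF x y, symmetric] using pq
      by (cases p; cases q; cases r)
        (auto intro!: V.subspace_diff[OF V.subspace_part] V.subspace_scale[OF V.subspace_part])
    moreover have "scl V (b x y) v \<in> part V r"
      using v(1) by (rule V.subspace_scale[OF V.subspace_part])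
    ultimately have "scl V (b x y) v = 0" by (cases r) (auto dest: V.part_disjoint)
    then show ?thesis using v(2) by simp
  qed
  have gp: "gvec i \<in> part witt_alg (gen_parity i)" for i by simp
  have gb: "gen_brk i j \<in> part witt_alg (gen_parity i + gen_parity j)" for i j
    using lie_superalgebra.brk_part[OF lie_superalgebra_witt gp gp, of i j] by simp
  have "two_cocycle witt_alg b"
  proof (rule two_cocycle_wittI[OF bl])
    fix i j k
    show "b (gvec i) (gvec j) = 0" if "gen_parity i + gen_parity j \<noteq> 0"
      using that par[OF gp gp, of i j] by auto
    show "b (gvec i) (gvec j) = - ksign (gen_parity i) (gen_parity j) * b (gvec j) (gvec i)"
    proof (rule scl_inj)
      have "P (gen_brk i j) v = scl V (- ksign (gen_parity i) (gen_parity j)) (P (gen_brk j i) v)"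
        by (subst gen_skew) (rule PD(3))
      then show "scl V (b (gvec i) (gvec j)) v
        = scl V (- ksign (gen_parity i) (gen_parity j) * b (gvec j) (gvec i)) v"
        unfolding V.scale_scale[symmetric] D[OF gp gp, symmetric]
        by (cases "gen_parity i"; cases "gen_parity j") (simp_all add: ksign_def algebra_simps)
    qed
    show "b (gvec i) (gen_brk j k) = b (gen_brk i j) (gvec k)
        + ksign (gen_parity i) (gen_parity j) * b (gvec j) (gen_brk i k)"
    proof (rule scl_inj)
      have jac: "P (witt_brk (gvec i) (gen_brk j k)) v = P (witt_brk (gen_brk i j) (gvec k)) v
        + scl V (ksign (gen_parity i) (gen_parity j)) (P (witt_brk (gvec j) (gen_brk i k)) v)"
        unfolding gen_jacobi[of i j k] PD(2,3) ..
      have gen: "P (gen_brk i j) w = P (gvec i) (P (gvec j) w)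
          - scl V (ksign (gen_parity i) (gen_parity j)) (P (gvec j) (P (gvec i) w))
          - scl V (b (gvec i) (gvec j)) w" for i j w
        using brk_eq[OF gp gp, of i j w] by simp
      have P_diff: "P x (v - w) = P x v - P x w" for x v w
        using PD(4)[of x "v - w" w] by (simp add: algebra_simps)
      have P_minus: "P x (- w) = - P x w" for x w
        using PD(5)[of x "-1" w] by simp
      have P_zero: "P x 0 = 0" for x using PD(5)[of x 0 0] by simp
      \<comment> \<open>Expanding nested brackets leaves terms \<open>b x y\<close> times
        \<open>P z v\<close>. They cancel when \<open>x\<close> and \<open>y\<close> have equal
        parity, their bracket being even; otherwise \<open>b x y\<close> is 0.\<close>
      note pars = par[OF gp gp, of i j] par[OF gp gp, of j k] par[OF gp gp, of i k]
      show "scl V (b (gvec i) (gen_brk j k)) v = scl V (b (gen_brk i j) (gvec k)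
        + ksign (gen_parity i) (gen_parity j) * b (gvec j) (gen_brk i k)) v"
        unfolding V.scale_left_distrib V.scale_scale[symmetric]
          D[OF gp gb, symmetric] D[OF gb gp, symmetric] jac using pars
        by (cases "gen_parity i"; cases "gen_parity j"; cases "gen_parity k")
          (simp_all add: gen P_diff P_minus P_zero ksign_def PD(4,5) algebra_simps)
    qed
  qed
  moreover have "projective_representation witt_alg V P b"
    unfolding projective_representation_def Vector_Spaces.linear_iff
    using vector_space_witt V.vector_space_axioms V.super_space_axioms PD brk_eq by simp
  ultimately show thesis by (rule that)
qed

text \<open>Shifting \<open>P x\<close> by the scalar \<open>f x\<close> absorbs the coboundary part
  of the cocycle, and letting \<open>(0, 1)\<close> act by \<open>k\<close> absorbs the rest. The
  clause on \<open>f 0\<close> is there to read off the action of the central element.\<close>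

lemma projective_representation_lift:
  fixes V :: "('v::ab_group_add) sspace"
  assumes P: "projective_representation witt_alg V P \<beta>" and nz: "(UNIV :: 'v set) \<noteq> {0}"
  obtains R f k where "representation ns_alg V R"
    "\<And>u v. R u v = P (fst u) v + scl V (f (fst u) + k * snd u) v" "f 0 = 0"
proof -
  obtain b where b: "two_cocycle witt_alg b" "projective_representation witt_alg V P b"
    by (rule projective_cocycle[OF P nz])
  obtain k f where f: "Vector_Spaces.linear witt_scl (*) f" "\<And>n. f (gvec (Ggen n)) = 0"
      and bk: "b = (\<lambda>x y. k * ns_cocycle x y + f (witt_brk x y))"
    by (rule cocycle_classification[OF b(1)]) blast
  note PD = projective_representationD[OF b(2), unfolded scl_witt_alg brk_witt_alg]
  interpret V: super_space V by (rule PD(1))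
  interpret N: super_space ns_alg by (rule super_space_ns_alg)
  interpret f: Vector_Spaces.linear witt_scl "(*)" f by (rule f(1))
  define a where "a u = f (fst u) + k * snd u" for u
  define R where "R u v = P (fst u) v + scl V (a u) v" for u v
  have a_lin: "a (u + w) = a u + a w" "a (scl ns_alg c u) = c * a u" for u w c
    by (simp_all add: a_def f.add f.scale extension_algebra_def distrib_left)
  \<comment> \<open>A scalar operator is even, so the shift has to vanish on odd elements; this also
    keeps it out of anticommutators.\<close>
  have odd: "a u = 0" if "u \<in> part ns_alg 1" for u
    using that even_form_odd_part[OF f] by (auto simp: a_def extension_algebra_def)
  have fst_part: "fst u \<in> part witt_alg p" if "u \<in> part ns_alg p" for u p
    using that by (auto simp: extension_algebra_def)
  have "representation ns_alg V R"
    unfolding representation_def projective_representation_def Vector_Spaces.linear_iff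
  proof (intro conjI allI ballI V.super_space_axioms N.vector_space_axioms V.vector_space_axioms)
    fix u w :: "witt \<times> complex" and v v' :: 'v and c
    show "R (u + w) v = R u v + R w v"
      by (simp add: R_def a_lin PD V.scale_left_distrib algebra_simps)
    show "R (scl ns_alg c u) v = scl V c (R u v)"
      unfolding R_def a_lin
      by (simp add: extension_algebra_def PD V.scale_right_distrib)
    show "R u (v + v') = R u v + R u v'"
      by (simp add: R_def PD V.scale_right_distrib algebra_simps)
    show "R u (scl V c v) = scl V c (R u v)"
      by (simp add: R_def PD V.scale_right_distrib mult.commute)
  next
    fix p q u v assume u: "u \<in> part ns_alg p" and v: "v \<in> part V q"
    have "P (fst u) v \<in> part V (p + q)" by (rule PD(6)[OF fst_part[OF u] v])
    moreover have "scl V (a u) v \<in> part V (p + q)"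
    proof (cases "p = 0")
      case True
      then show ?thesis using V.subspace_scale[OF V.subspace_part v] by (metis add_0)
    next
      case False
      then have "a u = 0" using odd[of u] u by (cases p) auto
      then show ?thesis using V.subspace_0[OF V.subspace_part] by simp
    qed
    ultimately show "R u v \<in> part V (p + q)"
      unfolding R_def by (rule V.subspace_add[OF V.subspace_part])
  next
    fix p q u w v assume u: "u \<in> part ns_alg p" and w: "w \<in> part ns_alg q"
    have a_brk: "a (brk ns_alg u w) = b (fst u) (fst w)"
      by (simp add: a_def bk extension_algebra_def)
    have P_brk: "P (fst (brk ns_alg u w)) v + scl V (b (fst u) (fst w)) v
      = P (fst u) (P (fst w) v) - scl V (ksign p q) (P (fst w) (P (fst u) v))"
      using PD(7)[OF fst_part[OF u] fst_part[OF w], of v] by (simp add: extension_algebra_def)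
    show "R u (R w v) - scl V (ksign p q) (R w (R u v)) = R (brk ns_alg u w) v + scl V 0 v"
      unfolding R_def a_brk P_brk using odd[of u] odd[of w] u w
      by (cases p; cases q)
        (simp_all add: ksign_def PD(4,5) V.scale_right_distrib mult.commute algebra_simps)
  qed
  then show thesis by (rule that[of R f k]) (simp_all add: R_def a_def f.zero)
qed

section \<open>Schur's lemma in countable dimension\<close>

context vector_space
begin

text \<open>Every element of \<open>B\<close> lies in the span of a finite subset of
  \<open>A\<close>. There are countably many such subsets, and each of these spans contains only
  finitely many elements of the independent set \<open>B\<close>.\<close>

lemma countable_independent_in_countable_span:
  assumes A: "countable A" and B: "independent B" "B \<subseteq> span A"
  shows "countable B"
proof -
  have "B \<subseteq> (\<Union>F\<in>{F. finite F \<and> F \<subseteq> A}. B \<inter> span F)"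
  proof
    fix x assume x: "x \<in> B"
    then have "x \<in> span A" using B by blast
    then obtain F r where "finite F" "F \<subseteq> A" "x = (\<Sum>a\<in>F. scale (r a) a)"
      by (auto simp: span_explicit)
    moreover from this have "x \<in> span F" by (auto intro: span_sum span_scale span_base)
    ultimately show "x \<in> (\<Union>F\<in>{F. finite F \<and> F \<subseteq> A}. B \<inter> span F)" using x by blast
  qed
  moreover have "countable (\<Union>F\<in>{F. finite F \<and> F \<subseteq> A}. B \<inter> span F)"
  proof (rule countable_UN)
    show "countable {F. finite F \<and> F \<subseteq> A}" using A by (rule countable_Collect_finite_subset)
    fix F assume "F \<in> {F. finite F \<and> F \<subseteq> A}"
    then have "finite F" by simp
    moreover have "independent (B \<inter> span F)" using B(1) independent_mono by blast
    ultimately show "countable (B \<inter> span F)"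
      using independent_span_bound[of F "B \<inter> span F"] countable_finite by blast
  qed
  ultimately show ?thesis by (rule countable_subset)
qed

end

section \<open>Polynomials in an operator, applied to a vector by the Horner scheme\<close>

definition poly_op :: "(complex \<Rightarrow> 'v \<Rightarrow> 'v) \<Rightarrow> ('v \<Rightarrow> 'v) \<Rightarrow> complex poly \<Rightarrow> 'v::ab_group_add \<Rightarrow> 'v" where
  "poly_op s T p v = fold_coeffs (\<lambda>a w. s a v + T w) p 0"

locale operator = vector_space s for s :: "complex \<Rightarrow> 'v::ab_group_add \<Rightarrow> 'v" +
  fixes T :: "'v \<Rightarrow> 'v"
  assumes lin: "Vector_Spaces.linear s s T"
begin

sublocale T: Vector_Spaces.linear s s T by (rule lin)

lemma poly_op_0 [simp]: "poly_op s T 0 v = 0"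
  by (simp add: poly_op_def)

lemma poly_op_pCons [simp]: "poly_op s T (pCons a p) v = s a v + T (poly_op s T p v)"
  by (cases "p = 0 \<and> a = 0") (auto simp: poly_op_def T.zero)

lemma poly_op_add: "poly_op s T (p + q) v = poly_op s T p v + poly_op s T q v"
  by (induction p q rule: poly_induct2) (simp_all add: scale_left_distrib T.add algebra_simps)

lemma poly_op_smult: "poly_op s T (smult c p) v = s c (poly_op s T p v)"
  by (induction p) (simp_all add: scale_right_distrib T.scale)

lemma poly_op_linear_factor:
  "poly_op s T ([:- r, 1:] * p) v = T (poly_op s T p v) - s r (poly_op s T p v)"
proof -
  have "[:- r, 1:] * p = smult (- r) p + pCons 0 p" by simp
  then show ?thesis by (simp only: poly_op_add poly_op_smult poly_op_pCons) simp
qed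

text \<open>Over the complex numbers \<open>p\<close> splits into linear factors, and each T - r is
  injective by assumption.\<close>

lemma poly_op_nonzero:
  assumes inj: "\<forall>c v. T v = s c v \<longrightarrow> v = 0" and v: "v \<noteq> 0" and p: "p \<noteq> 0"
  shows "poly_op s T p v \<noteq> 0"
  using p
proof (induction "degree p" arbitrary: p)
  case 0
  then obtain a where "p = [:a:]" "a \<noteq> 0" by (metis degree_eq_zeroE pCons_0_0)
  then show ?case using v by (simp add: T.zero)
next
  case (Suc n)
  then have "\<not> constant (poly p)" by (simp add: constant_degree)
  then obtain r where "poly p r = 0" using fundamental_theorem_of_algebra by blast
  then obtain q where q: "p = [:- r, 1:] * q" by (metis dvdE poly_eq_0_iff_dvd)
  have "q \<noteq> 0" using q Suc.prems by (metis mult_zero_right)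
  moreover from this have "degree p = Suc (degree q)"
    unfolding q by (subst degree_mult_eq) simp_all
  ultimately have "q \<noteq> 0" "degree q = n" using Suc.hyps(2) by simp_all
  then have "poly_op s T q v \<noteq> 0" using Suc by blast
  then show ?case using inj[rule_format, of "poly_op s T q v" r] by (auto simp only: q poly_op_linear_factor eq_iff_diff_eq_0[symmetric])
qed

text \<open>Multiplying by $T - d$ trades the term of index \<open>d\<close> for a polynomial in \<open>T\<close> applied to
  \<open>v\<close>, so polynomials have to be allowed on the right for the induction to go through.\<close>

lemma resolvent_vectors_independent_aux:
  assumes inj: "\<forall>c v. T v = s c v \<longrightarrow> v = 0" and v: "v \<noteq> 0"
    and u: "\<And>c. T (u c) - s c (u c) = v"
    and "finite F" "(\<Sum>c\<in>F. s (a c) (u c)) = poly_op s T p v"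
  shows "\<forall>c\<in>F. a c = 0"
  using assms(4,5)
proof (induction F arbitrary: a p rule: finite_induct)
  case (insert d F)
  have Tu: "T (u c) = v + s c (u c)" for c using u[of c] by (simp add: algebra_simps)
  let ?A = "\<Sum>c\<in>insert d F. a c"
  have "T (\<Sum>c\<in>insert d F. s (a c) (u c)) - s d (\<Sum>c\<in>insert d F. s (a c) (u c))
      = (\<Sum>c\<in>insert d F. s (a c) v + s (a c * (c - d)) (u c))"
    unfolding T.sum scale_sum_right sum_subtractf[symmetric]
    by (intro sum.cong) (simp_all add: T.scale Tu scale_right_distrib scale_left_diff_distrib
        right_diff_distrib mult.commute)
  also have "\<dots> = s ?A v + (\<Sum>c\<in>insert d F. s (a c * (c - d)) (u c))"
    by (simp only: sum.distrib scale_sum_left)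
  \<comment> \<open>The factor \<open>c - d\<close> removes the term of index
    \<open>d\<close>.\<close>
  also have "(\<Sum>c\<in>insert d F. s (a c * (c - d)) (u c)) = (\<Sum>c\<in>F. s (a c * (c - d)) (u c))"
    using insert by simp
  finally have "s ?A v + (\<Sum>c\<in>F. s (a c * (c - d)) (u c)) = poly_op s T ([:- d, 1:] * p) v"
    unfolding insert.prems poly_op_linear_factor by simp
  then have "(\<Sum>c\<in>F. s (a c * (c - d)) (u c)) = poly_op s T ([:- d, 1:] * p + [:- ?A:]) v"
    by (simp only: poly_op_add poly_op_pCons poly_op_0 T.zero) (simp add: algebra_simps)
  from insert.IH[OF this] have "\<forall>c\<in>F. a c * (c - d) = 0" .
  then have F0: "a c = 0" if "c \<in> F" for c using that insert.hyps by auto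
  then have "s (a d) (u d) = poly_op s T p v" using insert.prems insert.hyps by simp
  from arg_cong[OF this, of "\<lambda>w. T w - s d w"]
  have "s (a d) v = poly_op s T ([:- d, 1:] * p) v"
    unfolding poly_op_linear_factor
    by (simp add: T.scale Tu scale_right_distrib mult.commute)
  then have "poly_op s T ([:- d, 1:] * p + [:- a d:]) v = 0"
    by (simp only: poly_op_add poly_op_pCons poly_op_0 T.zero) simp
  then have "[:- d, 1:] * p + [:- a d:] = 0" using poly_op_nonzero[OF inj v] by blast
  \<comment> \<open>Evaluation at \<open>d\<close> kills the linear factor and isolates the last
    coefficient.\<close>
  then have "poly ([:- d, 1:] * p + [:- a d:]) d = 0" by simp
  then have "a d = 0" by simp
  then show ?case using F0 by simp
qed simp

lemma resolvent_vectors_independent: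
  assumes inj: "\<forall>c v. T v = s c v \<longrightarrow> v = 0" and v: "v \<noteq> 0"
    and u: "\<And>c. T (u c) - s c (u c) = v"
  shows "inj u" "independent (range u)"
proof -
  show ui: "inj u"
  proof (rule injI)
    fix c d assume eq: "u c = u d"
    have "s (c - d) (u d) = 0"
      using u[of c] u[of d] eq by (simp add: scale_left_diff_distrib algebra_simps)
    moreover have "u d \<noteq> 0" using u[of d] v by (auto simp: T.zero)
    ultimately show "c = d" by simp
  qed
  show "independent (range u)"
    unfolding independent_explicit_module
  proof (intro allI impI)
    fix F f x assume F: "finite F" "F \<subseteq> range u" "(\<Sum>x\<in>F. s (f x) x) = 0" "x \<in> F"
    obtain F' where F': "F = u ` F'" using F(2) by (auto simp: subset_image_iff)
    have "finite F'" using F(1) ui unfolding F' by (metis finite_imageD inj_on_subset subset_UNIV)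
    moreover have "(\<Sum>c\<in>F'. s (f (u c)) (u c)) = poly_op s T 0 v"
      using F(3) ui unfolding F' by (subst (asm) sum.reindex) (auto intro: inj_on_subset)
    ultimately have "\<forall>c\<in>F'. f (u c) = 0"
      by (rule resolvent_vectors_independent_aux[OF inj v u])
    then show "f x = 0" using F(4) F' by blast
  qed
qed

lemma has_eigenvector_if_countable_dim:
  assumes A: "countable A" "span A = UNIV" and v: "(v :: 'v) \<noteq> 0"
    and surj: "\<And>c. range (\<lambda>w. T w - s c w) = UNIV"
  shows "\<exists>c w. w \<noteq> 0 \<and> T w = s c w"
proof (rule ccontr)
  assume "\<not> ?thesis"
  then have inj: "\<forall>c w. T w = s c w \<longrightarrow> w = 0" by blast
  define u where "u c = inv (\<lambda>w. T w - s c w) v" for c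
  have u: "T (u c) - s c (u c) = v" for c
    unfolding u_def by (rule f_inv_into_f[of v "\<lambda>w. T w - s c w"]) (simp add: surj)
  have "countable (range u)"
    using countable_independent_in_countable_span[OF A(1) resolvent_vectors_independent(2)[OF inj v u]]
      A(2) by simp
  then have "countable (UNIV :: complex set)"
    using resolvent_vectors_independent(1)[OF inj v u] by (simp add: countable_image_inj_eq)
  \<comment> \<open>Uncountability is inherited from the reals embedded in the complex
    numbers.\<close>
  then have "countable (range complex_of_real)" by (rule countable_subset[rotated]) simp
  then have "countable (UNIV :: real set)" by (simp add: countable_image_inj_eq inj_of_real)
  then show False using uncountable_UNIV_real by blast
qed

end

text \<open>Words in the countable set \<open>S\<close> applied to one nonzero vector form a
  countable set with invariant span. Since the letters and the starting vector are homogeneous, the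
  span is graded, so irreducibility makes it the whole space.\<close>

lemma irreducible_countable_dim:
  fixes V :: "('v::ab_group_add) sspace" and E :: "('e::ab_group_add) salgebra"
  assumes R: "representation E V R" and irr: "irreducible_action V R"
    and E: "super_space E" and S: "countable S" "module.span (scl E) S = UNIV"
    and hom: "\<And>x. x \<in> S \<Longrightarrow> \<exists>p. x \<in> part E p"
  obtains A where "countable A" "module.span (scl V) A = UNIV"
proof -
  note RD = projective_representationD[OF R[unfolded representation_def]]
  interpret V: super_space V by (rule RD(1))
  interpret E: super_space E by (rule E)
  obtain v0 r where v0: "v0 \<in> part V r" "v0 \<noteq> 0"
    using V.homogeneous_nonzero irr by (metis irreducible_action_def)
  define A where "A = (\<lambda>xs. foldr R xs v0) ` lists S"
  have A_hom: "\<exists>p. w \<in> part V p" if "w \<in> A" for w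
  proof -
    have "\<exists>p. foldr R xs v0 \<in> part V p" if "xs \<in> lists S" for xs
      using that
    proof (induction xs)
      case (Cons x xs)
      then obtain p where "x \<in> part E p" using hom by auto
      moreover obtain q where "foldr R xs v0 \<in> part V q" using Cons by auto
      ultimately show ?case using RD(6) by fastforce
    qed (use v0 in auto)
    then show ?thesis using \<open>w \<in> A\<close> by (auto simp: A_def)
  qed
  have R_zero: "R x 0 = 0" "R 0 v = 0" for x v
    using RD(5)[of x 0 0] RD(3)[of 0 0 v] by simp_all
  have A_R: "R x w \<in> A" if x: "x \<in> S" and w: "w \<in> A" for x w
  proof -
    obtain xs where "xs \<in> lists S" "w = foldr R xs v0" using w by (auto simp: A_def)
    then have "R x w = foldr R (x # xs) v0" "x # xs \<in> lists S" using x by auto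
    then show ?thesis unfolding A_def by blast
  qed
  have inv: "R x w \<in> V.span A" if "w \<in> V.span A" for x w
  proof -
    have gen: "R x w \<in> V.span A" if x: "x \<in> S" for x
      using \<open>w \<in> V.span A\<close>
      by (induction rule: V.span_induct_alt)
        (simp_all add: R_zero RD V.span_zero V.span_add V.span_scale V.span_base A_R[OF x])
    \<comment> \<open>Linearity in the acting element passes from letters in \<open>S\<close> to all
      of \<open>E\<close>.\<close>
    have "x \<in> E.span S" using S(2) by simp
    then show ?thesis
      by (induction rule: E.span_induct_alt)
        (simp_all add: R_zero RD V.span_zero V.span_add V.span_scale gen)
  qed
  have graded: "\<exists>w0\<in>V.span A \<inter> part V 0. \<exists>w1\<in>V.span A \<inter> part V 1. w = w0 + w1"
    if "w \<in> V.span A" for w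
    using that
  proof (induction rule: V.span_induct_alt)
    case base
    show ?case
      using V.span_zero V.subspace_0[OF V.subspace_part] by (intro bexI[of _ 0]) auto
  next
    case (step c x y)
    then obtain w0 w1 where w: "w0 \<in> V.span A" "w0 \<in> part V 0" "w1 \<in> V.span A" "w1 \<in> part V 1"
      "y = w0 + w1" by blast
    obtain p where "x \<in> part V p" using A_hom step by blast
    then have cx: "scl V c x \<in> part V p" "scl V c x \<in> V.span A"
      using V.subspace_scale[OF V.subspace_part] step V.span_scale V.span_base by blast+
    show ?case
    proof (cases p)
      case zero
      then show ?thesis using w cx V.span_add V.subspace_add[OF V.subspace_part]
        by (intro bexI[of _ "scl V c x + w0"] bexI[of _ w1]) auto
    next
      case one
      then show ?thesis using w cx V.span_add V.subspace_add[OF V.subspace_part]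
        by (intro bexI[of _ w0] bexI[of _ "scl V c x + w1"]) (auto simp: algebra_simps)
    qed
  qed
  have "v0 \<in> V.span A"
    by (rule V.span_base) (auto simp: A_def intro: image_eqI[of _ _ "[]"])
  moreover have "V.span A = {0} \<or> V.span A = UNIV"
    using irr graded inv V.subspace_span unfolding irreducible_action_def by blast
  ultimately have "V.span A = UNIV" using v0 by blast
  moreover have "countable A" using S(1) by (simp add: A_def)
  ultimately show thesis using that by blast
qed

text \<open>An even central \<open>C\<close> commutes with the action without signs and preserves
  parity, so images and kernels of C - c are graded submodules. Without eigenvectors every image
  would be everything, contrary to the countable dimension; an eigenvector makes the corresponding
  kernel everything.\<close>

lemma central_acts_by_scalar:
  fixes V :: "('v::ab_group_add) sspace" and E :: "('e::ab_group_add) salgebra"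
  assumes R: "representation E V R" and irr: "irreducible_action V R"
    and E: "super_space E" and S: "countable S" "module.span (scl E) S = UNIV"
    and hom: "\<And>x. x \<in> S \<Longrightarrow> \<exists>p. x \<in> part E p"
    and C: "C \<in> part E 0" "\<And>x. brk E C x = 0"
  shows "\<exists>c. \<forall>v. R C v = scl V c v"
proof -
  note RD = projective_representationD[OF R[unfolded representation_def]]
  interpret V: super_space V by (rule RD(1))
  interpret E: super_space E by (rule E)
  have lin: "Vector_Spaces.linear (scl V) (scl V) (R C)"
    using RD V.vector_space_axioms by (simp add: Vector_Spaces.linear_iff)
  interpret T: operator "scl V" "R C"
    by (intro operator.intro operator_axioms.intro V.vector_space_axioms lin)
  have R_zero: "R 0 v = 0" for v using RD(3)[of 0 0 v] by simp
  have commute_hom: "R C (R x v) = R x (R C v)" if "x \<in> part E p" for x v p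
    using RD(7)[OF C(1) that, of v] by (simp add: C(2) R_zero ksign_def)
  have commute: "R C (R x v) = R x (R C v)" for x v
  proof -
    obtain y z where "y \<in> part E 0" "z \<in> part E 1" "x = y + z" using E.part_sum by blast
    then show ?thesis by (simp add: RD commute_hom)
  qed
  have C_part: "R C v - scl V c v \<in> part V p" if "v \<in> part V p" for v c p
    using RD(6)[OF C(1) that, unfolded add_0] that
    by (intro V.subspace_diff[OF V.subspace_part] V.subspace_scale[OF V.subspace_part])
  obtain A where A: "countable A" "V.span A = UNIV"
    by (rule irreducible_countable_dim[OF R irr E S hom])
  obtain v :: 'v where v: "v \<noteq> 0" using irr by (auto simp: irreducible_action_def)
  have split: "\<exists>y\<in>part V 0. \<exists>z\<in>part V 1. x = y + z" for x by (rule V.part_sum)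
  have R_diff: "R x (v - w) = R x v - R x w" for x v w
    using RD(4)[of x "v - w" w] by (simp add: algebra_simps)
  have shift: "R C (v + w) - scl V c (v + w) = (R C v - scl V c v) + (R C w - scl V c w)"
    "R C (scl V d v) - scl V c (scl V d v) = scl V d (R C v - scl V c v)"
    "R x (R C v - scl V c v) = R C (R x v) - scl V c (R x v)" for v w c d x
    by (simp_all add: RD V.scale_right_distrib V.scale_right_diff_distrib V.scale_left_commute
        R_diff commute)
  have "\<exists>c w. w \<noteq> 0 \<and> R C w = scl V c w"
  proof (rule ccontr)
    assume none: "\<not> ?thesis"
    have "range (\<lambda>w. R C w - scl V c w) = UNIV" for c
    proof -
      let ?W = "range (\<lambda>w. R C w - scl V c w)"
      have "V.subspace ?W"
      proof (rule V.subspaceI)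
        show "0 \<in> ?W" by (rule image_eqI[of _ _ 0]) (simp_all add: T.T.zero)
      next
        fix x y assume "x \<in> ?W" "y \<in> ?W"
        then obtain x' y' where "x = R C x' - scl V c x'" "y = R C y' - scl V c y'" by blast
        then have "x + y = R C (x' + y') - scl V c (x' + y')" by (simp only: shift(1))
        then show "x + y \<in> ?W" by blast
      next
        fix d x assume "x \<in> ?W"
        then obtain x' where "x = R C x' - scl V c x'" by blast
        then have "scl V d x = R C (scl V d x') - scl V c (scl V d x')" by (simp only: shift(2))
        then show "scl V d x \<in> ?W" by blast
      qed
      moreover have "\<exists>w0\<in>?W \<inter> part V 0. \<exists>w1\<in>?W \<inter> part V 1. w = w0 + w1" if w: "w \<in> ?W" for w
      proof -
        obtain x where x: "w = R C x - scl V c x" using w by blast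
        obtain y z where yz: "y \<in> part V 0" "z \<in> part V 1" "x = y + z" using split by blast
        then show ?thesis
          using C_part[OF yz(1), of c] C_part[OF yz(2), of c] shift(1)[of y z c] unfolding x yz(3)
          by (intro bexI[of _ "R C y - scl V c y"] bexI[of _ "R C z - scl V c z"]) auto
      qed
      moreover have "R x ` ?W \<subseteq> ?W" for x by (auto simp: shift(3))
      ultimately have "?W = {0} \<or> ?W = UNIV" using irr unfolding irreducible_action_def by blast
      \<comment> \<open>A zero image would turn \<open>v\<close> into an eigenvector.\<close>
      moreover have "R C v - scl V c v \<noteq> 0" using none v by auto
      ultimately show ?thesis by blast
    qed
    from T.has_eigenvector_if_countable_dim[OF A v this] none show False by blast
  qed
  then obtain c w where w: "w \<noteq> 0" "R C w = scl V c w" by blast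
  let ?W = "{w. R C w - scl V c w = 0}"
  have "V.subspace ?W"
  proof (rule V.subspaceI)
    show "0 \<in> ?W" by (simp add: T.T.zero)
  qed (simp_all only: mem_Collect_eq shift V.scale_zero_right add_0_left)
  moreover have "\<exists>w0\<in>?W \<inter> part V 0. \<exists>w1\<in>?W \<inter> part V 1. x = w0 + w1" if x: "x \<in> ?W" for x
  proof -
    obtain y z where yz: "y \<in> part V 0" "z \<in> part V 1" "x = y + z" using split by blast
    have sum: "(R C y - scl V c y) + (R C z - scl V c z) = 0"
      using x shift(1)[of y z c] yz(3) by simp
    \<comment> \<open>The two summands have opposite parity, so each of them vanishes separately;
      hence the eigenspace contains the components of its elements.\<close>
    then have "R C z - scl V c z = 0"
      using V.part_sum_unique[of 0 0 "R C y - scl V c y" "R C z - scl V c z"]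
        C_part[OF yz(1)] C_part[OF yz(2)] V.subspace_0[OF V.subspace_part] by simp
    with sum yz show ?thesis by (intro bexI[of _ y] bexI[of _ z]) simp_all
  qed
  moreover have "R x ` ?W \<subseteq> ?W" for x
  proof safe
    fix w assume "R C w - scl V c w = 0"
    then have "R x (R C w - scl V c w) = 0" using RD(5)[of x 0 0] by simp
    then show "R C (R x w) - scl V c (R x w) = 0" by (simp only: shift(3))
  qed
  ultimately have "?W = {0} \<or> ?W = UNIV" using irr unfolding irreducible_action_def by blast
  moreover have "w \<in> ?W" using w by simp
  ultimately have "?W = UNIV" using w(1) by blast
  then show ?thesis by (metis (mono_tags, lifting) UNIV_I eq_iff_diff_eq_0 mem_Collect_eq)
qed

section \<open>Irreducible representations and the central charge\<close>

text \<open>The Neveu-Schwarz basis is a countable homogeneous spanning set, as Schur's lemma in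
  this form requires.\<close>

lemma neveu_schwarz_central_scalar:
  fixes V :: "('v::ab_group_add) sspace" and E :: "('e::ab_group_add) salgebra"
  assumes basis: "neveu_schwarz_basis E \<pi> st L G C"
    and R: "representation E V R" "irreducible_action V R"
  shows "\<exists>c. \<forall>v. R C v = scl V c v"
proof -
  have ce: "central_extension witt_alg E \<pi> C" using basis by (simp add: neveu_schwarz_basis_def)
  let ?S = "range L \<union> range G \<union> {C}"
  show ?thesis
  proof (rule central_acts_by_scalar[OF R central_extensionD(4)[OF ce], of ?S])
    show "module.span (scl E) ?S = UNIV" using basis by (simp only: neveu_schwarz_basis_def)
    fix x assume "x \<in> ?S"
    then show "\<exists>p. x \<in> part E p"
      using basis central_extensionD(9)[OF ce] by (auto simp: neveu_schwarz_basis_def)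
  qed (use central_extensionD[OF ce] in auto)
qed

text \<open>The lift to \<open>ns_alg\<close> is pulled back along the equivalence that sends
  \<open>C\<close> to \<open>(0, 1)\<close>. The charge is thus the coefficient of
  \<open>ns_cocycle\<close> in the cocycle of \<open>P\<close>.\<close>

lemma neveu_schwarz_projective_lift:
  fixes V :: "('v::ab_group_add) sspace" and E :: "('e::ab_group_add) salgebra"
  assumes basis: "neveu_schwarz_basis E \<pi> st L G C"
    and P: "projective_representation witt_alg V P \<beta>" "irreducible_action V P"
  shows "\<exists>R g c. representation E V R \<and> (\<forall>x v. R x v = P (\<pi> x) v + scl V (g x) v)
    \<and> (\<forall>v. R C v = scl V c v)"
proof -
  have ce: "central_extension witt_alg E \<pi> C" using basis by (simp add: neveu_schwarz_basis_def)
  have nz: "(UNIV :: 'v set) \<noteq> {0}" using P(2) by (simp add: irreducible_action_def)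
  obtain R f k where R: "representation ns_alg V R"
      "\<And>u v. R u v = P (fst u) v + scl V (f (fst u) + k * snd u) v" "f 0 = 0"
    by (rule projective_representation_lift[OF P(1) nz]) blast
  obtain h where h: "lie_hom E ns_alg h" "\<And>x. fst (h x) = \<pi> x" "h C = (0, 1)"
    using equivalent_extensions_sym[OF super_space_ns_alg central_extensionD(4)[OF ce]
        neveu_schwarz_basis_equivalent[OF basis]]
    by (auto simp: equivalent_extensions_def)
  interpret V: super_space V using projective_representationD(1)[OF P(1)] .
  have "P 0 v = 0" for v
    using projective_representationD(3)[OF P(1), of 0 0 v] by simp
  then have "R (h C) v = scl V k v" for v by (simp add: R(2,3) h(3))
  moreover have "R (h x) v = P (\<pi> x) v + scl V (f (\<pi> x) + k * snd (h x)) v" for x v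
    by (simp add: R(2) h(2))
  ultimately show ?thesis
    using representation_pullback[OF h(1) R(1)]
    by (intro exI[of _ "\<lambda>x. R (h x)"] exI[of _ "\<lambda>x. f (\<pi> x) + k * snd (h x)"] exI[of _ k]) simp
qed

theorem proposition2p9:
  shows "vector_space.dim witt_H2_scl (UNIV :: witt_H2 set) = 1
    \<and> (\<exists>(E :: (witt \<times> complex) salgebra) \<pi> Z.
          central_extension witt_alg E \<pi> Z \<and> \<not> trivial_extension witt_alg E \<pi>)
    \<and> (\<forall>(E :: ('e::ab_group_add) salgebra) \<pi> Z (F :: ('f::ab_group_add) salgebra) \<pi>' Z'.
          central_extension witt_alg E \<pi> Z \<and> \<not> trivial_extension witt_alg E \<pi> \<and>
          central_extension witt_alg F \<pi>' Z' \<and> \<not> trivial_extension witt_alg F \<pi>' \<longrightarrow>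
          (\<exists>k. k \<noteq> 0 \<and> equivalent_extensions E \<pi> Z F \<pi>' (scl F k Z')))
    \<and> (\<forall>(E :: ('e::ab_group_add) salgebra) \<pi> Z.
          central_extension witt_alg E \<pi> Z \<and> \<not> trivial_extension witt_alg E \<pi> \<longrightarrow>
          (\<exists>st L G C. neveu_schwarz_basis E \<pi> st L G C) \<and>
          (\<forall>st L G C. neveu_schwarz_basis E \<pi> st L G C \<longrightarrow>
             (\<forall>(V :: ('v::ab_group_add) sspace) R.
                representation E V R \<and> irreducible_action V R \<longrightarrow>
                (\<exists>c. \<forall>v. R C v = scl V c v)) \<and>
             (\<forall>(V :: ('v::ab_group_add) sspace) P \<beta>.
                projective_representation witt_alg V P \<beta> \<and> irreducible_action V P \<longrightarrow>
                (\<exists>R g c. representation E V R \<and>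
                   (\<forall>x v. R x v = P (\<pi> x) v + scl V (g x) v) \<and>
                   (\<forall>v. R C v = scl V c v)))))"
proof (intro conjI allI impI; (elim conjE)?)
  show "vector_space.dim witt_H2_scl (UNIV :: witt_H2 set) = 1" by (rule dim_witt_H2)
  show "\<exists>(E :: (witt \<times> complex) salgebra) \<pi> Z.
      central_extension witt_alg E \<pi> Z \<and> \<not> trivial_extension witt_alg E \<pi>"
    using central_extension_ns_alg ns_alg_nontrivial by blast
qed (rule nontrivial_extensions_equivalent neveu_schwarz_basis_exists
    neveu_schwarz_central_scalar neveu_schwarz_projective_lift; assumption)+

end
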